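(* Let $A=A_{st}+A_{\mathcal I}\epsilon\in\mathbb{DQ}^{n\times n}$ be a Hermitian dual quaternion matrix with $A_{st}\ne O$. Then there are a unitary matrix $U\in\mathbb{DQ}^{n\times n}$ and a diagonal matrix $\Sigma\in\mathbb{D}^{n\times n}$ such that $\Sigma=U^*AU$, where $$\Sigma={\rm diag}\left(\lambda_1+\lambda_{1,1}\epsilon,\cdots,\lambda_1+\lambda_{1,k_1}\epsilon,\lambda_2+\lambda_{2,1}\epsilon,\cdots,\lambda_r+\lambda_{r,k_r}\epsilon\right),$$ the diagonal entries of $\Sigma$ are $n$ eigenvalues of $A$, and, writing $U=(\mathbf{u}_{1,1},\cdots,\mathbf{u}_{1,k_1},\cdots,\mathbf{u}_{r,k_r})$ by columns, $$A\mathbf{u}_{i,j}=\mathbf{u}_{i,j}(\lambda_i+\lambda_{i,j}\epsilon),\qquad j=1,\cdots,k_i,\ i=1,\cdots,r.$$ Here $\lambda_1>\lambda_2>\cdots>\lambda_r$ are real numbers, $\lambda_i$ is a $k_i$-multiple right eigenvalue of $A_{st}$, and $\lambda_{i,1}\ge\lambda_{i,2}\ge\cdots\ge\lambda_{i,k_i}$ are real numbers for each $i$. Counting possible multiplicities of the $\lambda_{i,j}$, the form $\Sigma$ is unique.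
   Context: $\mathbb{Q}$ denotes the real quaternions and $q^*$ the quaternion conjugate. $\epsilon$ is the infinitesimal unit: $\epsilon\neq 0$, $\epsilon^2=0$, and $\epsilon$ commutes with all quaternions. A dual number is $q_{st}+q_{\mathcal I}\epsilon$ with $q_{st},q_{\mathcal I}\in\mathbb{R}$ (set $\mathbb{D}$). A dual quaternion is $q=q_{st}+q_{\mathcal I}\epsilon$ with $q_{st},q_{\mathcal I}\in\mathbb{Q}$ (set $\mathbb{DQ}$), with conjugate $q^*=q_{st}^*+q_{\mathcal I}^*\epsilon$; it is appreciable if $q_{st}\ne0$. A vector in $\mathbb{DQ}^n$ is appreciable if at least one component is appreciable. A matrix over $\mathbb{DQ}$ is written $A=A_{st}+A_{\mathcal I}\epsilon$ with quaternion matrices $A_{st},A_{\mathcal I}$; $^*$ denotes conjugate transpose. $A$ is Hermitian if $A^*=A$; a square matrix $U$ is unitary if $U^*U=I$. Right eigenvalue of $A\in\mathbb{DQ}^{n\times n}$: $\lambda\in\mathbb{DQ}$ such that $A\mathbf{x}=\mathbf{x}\lambda$ for some appreciable $\mathbf{x}\in\mathbb{DQ}^n$; if $\lambda$ is a dual number it is called an eigenvalue of $A$, with $\mathbf{x}$ an associated eigenvector. For a quaternion matrix $A_{st}$, a right eigenvalue is $\lambda\in\mathbb{Q}$ with $A_{st}\mathbf{x}=\mathbf{x}\lambda$ for some nonzero $\mathbf{x}\in\mathbb{Q}^n$. A quaternion Hermitian matrix is diagonalizable by a quaternion unitary matrix, with real diagonal entries, which are its right eigenvalues; a right eigenvalue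 is $k$-multiple if it occurs exactly $k$ times on this diagonal. *)

theory Defs
  imports Complex_Main "Jordan_Normal_Form.Matrix"
begin

class star =
  fixes star :: "'a \<Rightarrow> 'a"

text \<open>The conjugation of (dual) quaternions reverses products, so the conjugation classes of
  \<open>Jordan_Normal_Form\<close>, which require a homomorphism, do not apply.\<close>

class star_ring = ring_1 + star +
  assumes star_star [simp]: "star (star x) = x"
    and star_add [simp]: "star (x + y) = star x + star y"
    and star_mult [simp]: "star (x * y) = star y * star x"
    and star_one [simp]: "star 1 = 1"

lemma star_zero [simp]: "star (0::'a::star_ring) = 0"
  using star_add[of "0::'a" 0] by simp

datatype quat = Quat (QRe: real) (QI: real) (QJ: real) (QK: real)

instantiation quat :: real_algebra_1
begin

definition "0 = Quat 0 0 0 0"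
definition "1 = Quat 1 0 0 0"
definition "x + y = Quat (QRe x + QRe y) (QI x + QI y) (QJ x + QJ y) (QK x + QK y)"
definition "- x = Quat (- QRe x) (- QI x) (- QJ x) (- QK x)"
definition "x - y = Quat (QRe x - QRe y) (QI x - QI y) (QJ x - QJ y) (QK x - QK y)"
definition "c *\<^sub>R x = Quat (c * QRe x) (c * QI x) (c * QJ x) (c * QK x)"
definition "x * y = Quat
  (QRe x * QRe y - QI x * QI y - QJ x * QJ y - QK x * QK y)
  (QRe x * QI y + QI x * QRe y + QJ x * QK y - QK x * QJ y)
  (QRe x * QJ y - QI x * QK y + QJ x * QRe y + QK x * QI y)
  (QRe x * QK y + QI x * QJ y - QJ x * QI y + QK x * QRe y)"

lemmas quat_defs = zero_quat_def one_quat_def plus_quat_def uminus_quat_def minus_quat_def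
  scaleR_quat_def times_quat_def

instance
  by standard (simp_all add: quat_defs algebra_simps)

end

instantiation quat :: star_ring
begin

definition "star x = Quat (QRe x) (- QI x) (- QJ x) (- QK x)"

instance
  by standard (simp_all add: star_quat_def quat_defs algebra_simps)

end

lemma of_real_quat: "of_real c = Quat c 0 0 0"
  by (simp add: of_real_def quat_defs)

lemma quat_units:
  defines "i \<equiv> Quat 0 1 0 0" and "j \<equiv> Quat 0 0 1 0" and "k \<equiv> Quat 0 0 0 1"
  shows "i * i = -1" "j * j = -1" "k * k = -1" "i * j = k" "j * k = i" "k * i = j"
  by (simp_all add: i_def j_def k_def quat_defs)

text \<open>\<open>Dual a b\<close> stands for $a + b\epsilon$, where $\epsilon$ is central and $\epsilon^2 = 0$;
  \<open>quat dual\<close> is the ring of dual quaternions.\<close>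

datatype 'a dual = Dual (std_part: 'a) (inf_part: 'a)

instantiation dual :: (ring_1) ring_1
begin

definition "0 = Dual 0 0"
definition "1 = Dual 1 0"
definition "x + y = Dual (std_part x + std_part y) (inf_part x + inf_part y)"
definition "- x = Dual (- std_part x) (- inf_part x)"
definition "x - y = Dual (std_part x - std_part y) (inf_part x - inf_part y)"
definition "x * y = Dual (std_part x * std_part y)
  (std_part x * inf_part y + inf_part x * std_part y)"

lemmas dual_defs = zero_dual_def one_dual_def plus_dual_def uminus_dual_def minus_dual_def
  times_dual_def

instance
  proof
  fix a b c :: "'a dual"
  show "a * b * c = a * (b * c)" by (simp add: dual_defs distrib_left distrib_right mult.assoc add.assoc)
  show "(a + b) * c = a * c + b * c" "c * (a + b) = c * a + c * b"
    by (simp_all add: dual_defs distrib_left distrib_right add_ac)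
  show "a + b + c = a + (b + c)" "a + b = b + a"
    by (simp_all add: dual_defs add_ac)
qed (simp_all add: dual_defs)

end

instantiation dual :: (star_ring) star_ring
begin

definition "star x = Dual (star (std_part x)) (star (inf_part x))"

instance
  by standard (simp_all add: star_dual_def dual_defs add.commute)

end

definition eps :: "'a::ring_1 dual" where
  "eps = Dual 0 1"

lemma eps_nonzero: "eps \<noteq> 0"
  and eps_squared: "eps * eps = 0"
  and eps_commute: "eps * Dual a 0 = Dual a 0 * eps"
  and Dual_eq: "Dual a b = Dual a 0 + Dual b 0 * eps"
  by (simp_all add: eps_def dual_defs)

definition is_dual_number :: "quat dual \<Rightarrow> bool" where
  "is_dual_number q \<longleftrightarrow> std_part q \<in> \<real> \<and> inf_part q \<in> \<real>"

definition conj_transpose :: "'a::star mat \<Rightarrow> 'a mat" where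
  "conj_transpose A = map_mat star (transpose_mat A)"

definition hermitian_mat :: "'a::star mat \<Rightarrow> bool" where
  "hermitian_mat A \<longleftrightarrow> conj_transpose A = A"

definition unitary_mat :: "'a::star_ring mat \<Rightarrow> bool" where
  "unitary_mat U \<longleftrightarrow> square_mat U \<and> conj_transpose U * U = 1\<^sub>m (dim_row U)"

text \<open>Scalars act on column vectors from the right; the library's \<open>smult_vec\<close> acts from the
  left.\<close>

definition rsmult_vec :: "'a::times vec \<Rightarrow> 'a \<Rightarrow> 'a vec" where
  "rsmult_vec x c = map_vec (\<lambda>a. a * c) x"

definition appreciable_vec :: "quat dual vec \<Rightarrow> bool" where
  "appreciable_vec x \<longleftrightarrow> (\<exists>i<dim_vec x. std_part (x $ i) \<noteq> 0)"

definition dq_right_eigenvalue :: "quat dual mat \<Rightarrow> quat dual \<Rightarrow> bool" where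
  "dq_right_eigenvalue A c \<longleftrightarrow> (\<exists>x \<in> carrier_vec (dim_row A).
     appreciable_vec x \<and> A *\<^sub>v x = rsmult_vec x c)"

definition dq_eigenvalue :: "quat dual mat \<Rightarrow> quat dual \<Rightarrow> bool" where
  "dq_eigenvalue A c \<longleftrightarrow> is_dual_number c \<and> dq_right_eigenvalue A c"

definition quat_right_eigenvalue :: "quat mat \<Rightarrow> quat \<Rightarrow> bool" where
  "quat_right_eigenvalue A c \<longleftrightarrow> (\<exists>x \<in> carrier_vec (dim_row A).
     x \<noteq> 0\<^sub>v (dim_row A) \<and> A *\<^sub>v x = rsmult_vec x c)"

text \<open>Meant for Hermitian \<open>A\<close>: the multiplicity is the number of occurrences on the diagonal in a
  unitary diagonalization of \<open>A\<close>, which does not depend on the diagonalization.\<close>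

definition multiple_right_eigenvalue :: "nat \<Rightarrow> quat mat \<Rightarrow> quat \<Rightarrow> bool" where
  "multiple_right_eigenvalue k A c \<longleftrightarrow> quat_right_eigenvalue A c \<and>
     (\<exists>V \<in> carrier_mat (dim_row A) (dim_row A). \<exists>d :: nat \<Rightarrow> real.
        unitary_mat V \<and>
        conj_transpose V * A * V = mat_diag (dim_row A) (\<lambda>p. of_real (d p)) \<and>
        card {p. p < dim_row A \<and> of_real (d p) = c} = k)"

text \<open>Blocks and positions inside a block are counted from 0: the pair $(i,j)$ with $j < k_i$
  labels the row or column $k_0 + \dots + k_{i-1} + j$.\<close>

definition block_pos :: "(nat \<Rightarrow> nat) \<Rightarrow> nat \<Rightarrow> nat \<Rightarrow> nat" where
  "block_pos k i j = (\<Sum>p<i. k p) + j"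

definition ordered_diagonal_form ::
  "nat \<Rightarrow> nat \<Rightarrow> (nat \<Rightarrow> nat) \<Rightarrow> (nat \<Rightarrow> real) \<Rightarrow> (nat \<Rightarrow> nat \<Rightarrow> real) \<Rightarrow> quat dual mat \<Rightarrow> bool"
where
  "ordered_diagonal_form n r k l m S \<longleftrightarrow>
     S \<in> carrier_mat n n \<and> diagonal_mat S \<and>
     (\<forall>i<r. 0 < k i) \<and> (\<Sum>i<r. k i) = n \<and>
     (\<forall>i<r. \<forall>j<k i. S $$ (block_pos k i j, block_pos k i j)
        = Dual (of_real (l i)) (of_real (m i j))) \<and>
     (\<forall>i i'. i < i' \<and> i' < r \<longrightarrow> l i > l i') \<and>
     (\<forall>i<r. \<forall>j j'. j \<le> j' \<and> j' < k i \<longrightarrow> m i j \<ge> m i j')"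

end

theory Submission
  imports Defs "Jordan_Normal_Form.Spectral_Radius" "HOL-Combinatorics.Permutations"
    "HOL-Library.Product_Lexorder"
begin

text \<open>Right multiplication by complex numbers turns a quaternion matrix into a complex matrix of
  twice the size, which has an eigenvector; Householder deflation then gives the spectral theorem for
  quaternion Hermitian matrices. For a dual matrix, diagonalize the standard part to reach
  \<open>D + B \<epsilon>\<close>. Conjugation by \<open>1 + P \<epsilon>\<close> adds \<open>D P - P D\<close> to \<open>B\<close>, and a suitable skew-Hermitian
  \<open>P\<close> leaves only the entries of \<open>B\<close> inside the eigenspaces of \<open>D\<close>; the remaining \<open>B\<close> commutes
  with \<open>D\<close> and is diagonalized together with it.

  For uniqueness, a unitary \<open>W\<close> with \<open>\<Sigma> W = W \<Sigma>'\<close> has \<open>w\<^sub>p\<^sub>q\<close> infinitesimal unless the entries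
  \<open>p\<close> of \<open>\<Sigma>\<close> and \<open>q\<close> of \<open>\<Sigma>'\<close> agree. As the \<open>|w\<^sub>p\<^sub>q|\<^sup>2\<close> of the standard part form a doubly
  stochastic matrix, both diagonals contain every value equally often.\<close>

section \<open>Conjugate transposes and unitary matrices\<close>

lemma index_mult_mat_sum:
  assumes "A \<in> carrier_mat a b" "B \<in> carrier_mat b c" "i < a" "j < c"
  shows "(A * B) $$ (i, j) = (\<Sum>t<b. A $$ (i, t) * B $$ (t, j))"
  using assms by (auto simp: scalar_prod_def atLeast0LessThan)

lemma index_mult_mat_vec_sum:
  assumes "A \<in> carrier_mat a b" "x \<in> carrier_vec b" "i < a"
  shows "(A *\<^sub>v x) $ i = (\<Sum>t<b. A $$ (i, t) * x $ t)"
  using assms by (auto simp: scalar_prod_def atLeast0LessThan)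

lemma star_sum: "star (\<Sum>i\<in>I. f i) = (\<Sum>i\<in>I. star (f i :: 'a::star_ring))"
  by (induction I rule: infinite_finite_induct) auto

lemma star_uminus [simp]: "star (- x) = - star (x :: 'a::star_ring)"
proof -
  have "star (- x) + star x = star (- x + x)" by (simp only: star_add)
  then show ?thesis by (simp add: eq_neg_iff_add_eq_0)
qed

lemma star_diff [simp]: "star (x - y) = star x - star (y :: 'a::star_ring)"
  by (metis diff_conv_add_uminus star_add star_uminus)

lemma conj_transpose_carrier [simp]:
  "A \<in> carrier_mat a b \<Longrightarrow> conj_transpose A \<in> carrier_mat b a"
  by (simp add: conj_transpose_def)

lemma dim_conj_transpose [simp]:
  "dim_row (conj_transpose A) = dim_col A" "dim_col (conj_transpose A) = dim_row A"
  by (simp_all add: conj_transpose_def)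

lemma index_conj_transpose [simp]:
  "i < dim_col A \<Longrightarrow> j < dim_row A \<Longrightarrow> conj_transpose A $$ (i, j) = star (A $$ (j, i))"
  by (simp add: conj_transpose_def)

lemma conj_transpose_conj_transpose [simp]:
  "conj_transpose (conj_transpose A) = (A :: 'a::star_ring mat)"
  by (rule eq_matI) auto

lemma conj_transpose_mult:
  fixes A B :: "'a::star_ring mat"
  assumes "A \<in> carrier_mat a b" "B \<in> carrier_mat b c"
  shows "conj_transpose (A * B) = conj_transpose B * conj_transpose A"
proof (rule eq_matI)
  fix i j
  assume "i < dim_row (conj_transpose B * conj_transpose A)"
    "j < dim_col (conj_transpose B * conj_transpose A)"
  then have ij: "i < c" "j < a" using assms by auto
  have "conj_transpose (A * B) $$ (i, j) = star ((A * B) $$ (j, i))"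
    using ij assms by simp
  also have "\<dots> = (\<Sum>t<b. star (B $$ (t, i)) * star (A $$ (j, t)))"
    using ij by (simp only: index_mult_mat_sum[OF assms] star_sum star_mult)
  also have "\<dots> = (conj_transpose B * conj_transpose A) $$ (i, j)"
    using ij assms
    by (subst index_mult_mat_sum[of _ c b _ a]) auto
  finally show "conj_transpose (A * B) $$ (i, j) = (conj_transpose B * conj_transpose A) $$ (i, j)" .
qed (use assms in auto)

lemma conj_transpose_one [simp]: "conj_transpose (1\<^sub>m n) = (1\<^sub>m n :: 'a::star_ring mat)"
  by (rule eq_matI) auto

lemma conj_transpose_minus:
  fixes A B :: "'a::star_ring mat"
  assumes "A \<in> carrier_mat a b" "B \<in> carrier_mat a b"
  shows "conj_transpose (A - B) = conj_transpose A - conj_transpose B"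
  using assms by (intro eq_matI) auto

lemma unitary_mat_iff:
  "U \<in> carrier_mat n n \<Longrightarrow> unitary_mat U \<longleftrightarrow> conj_transpose U * U = 1\<^sub>m n"
  by (auto simp: unitary_mat_def)

lemma congruence_mult:
  fixes A U V :: "'a::star_ring mat"
  assumes "A \<in> carrier_mat n n" "U \<in> carrier_mat n n" "V \<in> carrier_mat n n"
  shows "conj_transpose (U * V) * A * (U * V) = conj_transpose V * (conj_transpose U * A * U) * V"
  using assms
  by (simp add: conj_transpose_mult[of U n n V n] assoc_mult_mat[of _ n n _ n _ n]
      mult_carrier_mat[of _ n n _ n])

lemma unitary_mult:
  fixes U V :: "'a::star_ring mat"
  assumes "U \<in> carrier_mat n n" "V \<in> carrier_mat n n" "unitary_mat U" "unitary_mat V"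
  shows "unitary_mat (U * V)"
proof -
  have "conj_transpose (U * V) * (U * V) = conj_transpose V * (conj_transpose U * U * V)"
    using assms by (simp add: conj_transpose_mult[of U n n V n] assoc_mult_mat[of _ n n _ n _ n])
  then show ?thesis using assms by (auto simp: unitary_mat_iff[of _ n])
qed

lemma hermitian_congruence:
  fixes A U :: "'a::star_ring mat"
  assumes "A \<in> carrier_mat n n" "U \<in> carrier_mat n n" "hermitian_mat A"
  shows "hermitian_mat (conj_transpose U * A * U)"
  using assms
  by (simp add: hermitian_mat_def conj_transpose_mult[of _ n n _ n] assoc_mult_mat[of _ n n _ n _ n])

lemma hermitian_index:
  "hermitian_mat A \<Longrightarrow> A \<in> carrier_mat n n \<Longrightarrow> i < n \<Longrightarrow> j < n \<Longrightarrow> star (A $$ (i, j)) = A $$ (j, i)"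
  unfolding hermitian_mat_def by (metis carrier_matD index_conj_transpose)

section \<open>Quaternions\<close>

definition qsq :: "quat \<Rightarrow> real" where
  "qsq x = (QRe x)\<^sup>2 + (QI x)\<^sup>2 + (QJ x)\<^sup>2 + (QK x)\<^sup>2"

lemma star_mult_self: "star x * x = of_real (qsq x)"
  by (simp add: star_quat_def quat_defs of_real_quat qsq_def power2_eq_square)

lemma mult_star_self: "x * star x = of_real (qsq x)"
  by (simp add: star_quat_def quat_defs of_real_quat qsq_def power2_eq_square)

lemma qsq_star [simp]: "qsq (star x) = qsq x"
  by (simp add: qsq_def star_quat_def)

lemma qsq_nonneg [simp]: "0 \<le> qsq x"
  by (simp add: qsq_def)

lemma qsq_eq_0_iff [simp]: "qsq x = 0 \<longleftrightarrow> x = 0"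
proof
  assume "qsq x = 0"
  then have "QRe x = 0" "QI x = 0" "QJ x = 0" "QK x = 0"
    by (auto simp: qsq_def add_nonneg_eq_0_iff)
  then show "x = 0" by (cases x) (simp add: zero_quat_def)
qed (simp add: qsq_def zero_quat_def)

lemma star_of_real [simp]: "star (of_real c :: quat) = of_real c"
  by (simp add: of_real_quat star_quat_def)

lemma QRe_of_real [simp]: "QRe (of_real c) = c"
  by (simp add: of_real_quat)

lemma QRe_add [simp]: "QRe (x + y) = QRe x + QRe y"
  by (simp add: plus_quat_def)

lemma QRe_diff [simp]: "QRe (x - y) = QRe x - QRe y"
  by (simp add: minus_quat_def)

lemma QRe_zero [simp]: "QRe 0 = 0"
  by (simp add: zero_quat_def)

lemma QRe_sum: "QRe (\<Sum>i\<in>I. f i) = (\<Sum>i\<in>I. QRe (f i))"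
  by (induction I rule: infinite_finite_induct) auto

lemma QRe_mult_commute: "QRe (x * y) = QRe (y * x)"
  by (simp add: times_quat_def)

lemma quat_self_adjoint_real: "star x = (x::quat) \<Longrightarrow> x = of_real (QRe x)"
  by (cases x) (simp add: star_quat_def of_real_quat)

lemma star_scaleR_quat [simp]: "star (c *\<^sub>R (x::quat)) = c *\<^sub>R star x"
  by (simp add: star_quat_def scaleR_quat_def)

section \<open>The real trace and right inverses of quaternion unitary matrices\<close>

definition retrace :: "quat mat \<Rightarrow> real" where
  "retrace A = (\<Sum>i<dim_row A. QRe (A $$ (i, i)))"

text \<open>Quaternion entries do not commute, so the full trace is not cyclic; the real part of a
  product of two quaternions, however, does not depend on their order.\<close>

lemma retrace_mult_commute:
  assumes "A \<in> carrier_mat a b" "B \<in> carrier_mat b a"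
  shows "retrace (A * B) = retrace (B * A)"
proof -
  have "retrace (A * B) = (\<Sum>i<a. \<Sum>t<b. QRe (A $$ (i, t) * B $$ (t, i)))"
    using assms by (auto simp: retrace_def QRe_sum index_mult_mat_sum[OF assms] simp del: index_mult_mat(1))
  also have "\<dots> = (\<Sum>t<b. \<Sum>i<a. QRe (B $$ (t, i) * A $$ (i, t)))"
    by (subst sum.swap) (simp add: QRe_mult_commute)
  also have "\<dots> = retrace (B * A)"
    using assms by (auto simp: retrace_def QRe_sum index_mult_mat_sum[OF assms(2,1)] simp del: index_mult_mat(1))
  finally show ?thesis .
qed

text \<open>This is the squared Frobenius norm. A vanishing trace of
  \<open>conj_transpose A * A\<close> therefore forces every entry of \<open>A\<close> to
  vanish.\<close>

lemma retrace_conj_transpose_mult: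
  assumes "A \<in> carrier_mat a b"
  shows "retrace (conj_transpose A * A) = (\<Sum>j<b. \<Sum>i<a. qsq (A $$ (i, j)))"
proof -
  have "(conj_transpose A * A) $$ (j, j) = (\<Sum>i<a. of_real (qsq (A $$ (i, j))))" if "j < b" for j
    using that assms by (subst index_mult_mat_sum[of _ b a _ b]) (auto simp: star_mult_self)
  then show ?thesis using assms by (simp add: retrace_def QRe_sum del: index_mult_mat(1))
qed

text \<open>The defect \<open>1 - U * U\<^sup>*\<close> is a Hermitian idempotent with vanishing trace, and the trace of a
  Hermitian idempotent is the sum of the squared moduli of its entries.\<close>

lemma quat_unitary_right_inverse:
  assumes U: "U \<in> carrier_mat n n" and uni: "unitary_mat (U :: quat mat)"
  shows "U * conj_transpose U = 1\<^sub>m n"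
proof -
  define C where "C = conj_transpose U"
  have C: "C \<in> carrier_mat n n" and CU: "C * U = 1\<^sub>m n"
    using U uni by (simp_all add: C_def unitary_mat_iff)
  define Y where "Y = 1\<^sub>m n - U * C"
  have UC: "U * C \<in> carrier_mat n n" using U C by simp
  have Y: "Y \<in> carrier_mat n n" using UC unfolding Y_def by (rule minus_carrier_mat)
  have herm: "conj_transpose Y = Y"
    using U C unfolding Y_def by (simp add: conj_transpose_minus[of _ n n] conj_transpose_mult[of _ n n _ n] C_def)
  have idem: "(U * C) * (U * C) = U * C"
  proof -
    have "(U * C) * (U * C) = U * ((C * U) * C)"
      using U C by (simp add: assoc_mult_mat[of _ n n _ n _ n])
    then show ?thesis using CU C by simp
  qed
  have "Y * Y = Y * 1\<^sub>m n - Y * (U * C)"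
    using UC Y unfolding Y_def by (intro mult_minus_distrib_mat[of _ n n _ n]) auto
  moreover have "Y * (U * C) = 1\<^sub>m n * (U * C) - (U * C) * (U * C)"
    using UC unfolding Y_def by (intro minus_mult_distrib_mat[of _ n n _ _ n]) auto
  moreover have "\<dots> = 0\<^sub>m n n"
    using UC by (simp only: idem left_mult_one_mat) (auto intro!: eq_matI)
  ultimately have YY: "Y * Y = Y"
    using Y by (auto intro!: eq_matI simp del: index_mult_mat(1))
  have "retrace Y = retrace (1\<^sub>m n) - retrace (U * C)"
  proof -
    have "(\<Sum>i<n. QRe (Y $$ (i, i))) = (\<Sum>i<n. QRe ((1\<^sub>m n :: quat mat) $$ (i, i)) - QRe ((U * C) $$ (i, i)))"
      using UC U C unfolding Y_def
      by (intro sum.cong) (simp_all del: index_mult_mat(1) index_one_mat(1))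
    then show ?thesis using Y UC U unfolding retrace_def sum_subtractf by simp
  qed
  also have "\<dots> = 0" using retrace_mult_commute[OF U C] CU by simp
  finally have "(\<Sum>j<n. \<Sum>i<n. qsq (Y $$ (i, j))) = 0"
    using retrace_conj_transpose_mult[OF Y] herm YY by simp
  then have "\<forall>j<n. \<forall>i<n. Y $$ (i, j) = 0"
    by (simp add: sum_nonneg_eq_0_iff sum_nonneg)
  then have "(1\<^sub>m n :: quat mat) $$ (i, j) = (U * C) $$ (i, j)" if "i < n" "j < n" for i j
    using that UC U C unfolding Y_def by (simp del: index_mult_mat(1) index_one_mat(1))
  then show ?thesis
    using UC U by (intro eq_matI) (auto simp: C_def simp del: index_mult_mat(1) index_one_mat(1))
qed

text \<open>A zero column would put 0 on the diagonal of \<open>conj_transpose V * V\<close>.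
  Applied to the standard part of a dual unitary matrix, this makes its columns appreciable.\<close>

lemma unitary_col_nonzero:
  fixes V :: "quat mat"
  assumes V: "V \<in> carrier_mat n n" "unitary_mat V" and p: "p < n"
  shows "\<exists>i<n. V $$ (i, p) \<noteq> 0"
proof (rule ccontr)
  assume "\<not> ?thesis"
  then have "(conj_transpose V * V) $$ (p, p) = 0"
    using V(1) p by (subst index_mult_mat_sum[of _ n n _ n]) auto
  then show False using V p by (simp add: unitary_mat_iff del: index_mult_mat(1))
qed

section \<open>Eigenvectors of quaternion Hermitian matrices\<close>

text \<open>A quaternion is written as \<open>u + j v\<close> with complex \<open>u\<close>, \<open>v\<close>, so that right multiplication by
  a complex number acts componentwise. The sign in \<open>cv\<close> comes from \<open>j i = - k\<close>.\<close>

definition cu :: "quat \<Rightarrow> complex" where "cu x = Complex (QRe x) (QI x)"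
definition cv :: "quat \<Rightarrow> complex" where "cv x = Complex (QJ x) (- QK x)"

text \<open>Moving a complex number past j conjugates it, which is where \<open>cnj\<close> comes
  from. If \<open>cv y = 0\<close>, both coordinates of \<open>x\<close> are simply multiplied by
  \<open>cu y\<close>.\<close>

lemma cu_mult: "cu (x * y) = cu x * cu y - cnj (cv x) * cv y"
  and cv_mult: "cv (x * y) = cnj (cu x) * cv y + cv x * cu y"
  by (simp_all add: cu_def cv_def times_quat_def complex_eq_iff algebra_simps)

lemma cu_sum: "cu (\<Sum>i\<in>I. f i) = (\<Sum>i\<in>I. cu (f i))"
  and cv_sum: "cv (\<Sum>i\<in>I. f i) = (\<Sum>i\<in>I. cv (f i))"
proof -
  have [simp]: "cu (x + y) = cu x + cu y" "cv (x + y) = cv x + cv y" "cu 0 = 0" "cv 0 = 0" for x y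
    by (simp_all add: cu_def cv_def quat_defs complex_eq_iff)
  show "cu (\<Sum>i\<in>I. f i) = (\<Sum>i\<in>I. cu (f i))" "cv (\<Sum>i\<in>I. f i) = (\<Sum>i\<in>I. cv (f i))"
    by (induction I rule: infinite_finite_induct; simp)+
qed

lemma quat_eqI_complex: "cu x = cu y \<Longrightarrow> cv x = cv y \<Longrightarrow> x = y"
  by (cases x; cases y) (auto simp: cu_def cv_def)

definition quat_of_complex :: "complex \<Rightarrow> complex \<Rightarrow> quat" where
  "quat_of_complex u v = Quat (Re u) (Im u) (Re v) (- Im v)"

lemma cu_quat_of_complex [simp]: "cu (quat_of_complex u v) = u"
  and cv_quat_of_complex [simp]: "cv (quat_of_complex u v) = v"
  by (simp_all add: cu_def cv_def quat_of_complex_def complex_eq_iff)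

lemma sum_lessThan_add: "(\<Sum>t<a + b. f t) = (\<Sum>t<a. f t) + (\<Sum>t<b. f (a + t :: nat) :: 'a::comm_monoid_add)"
proof -
  have "(\<Sum>t<a + b. f t) = (\<Sum>t\<in>{..<a} \<union> {a..<a+b}. f t)" by (rule sum.cong) auto
  also have "\<dots> = (\<Sum>t<a. f t) + (\<Sum>t\<in>{a..<a+b}. f t)" by (rule sum.union_disjoint) auto
  also have "(\<Sum>t\<in>{a..<a+b}. f t) = (\<Sum>t<b. f (a + t))"
    by (rule sum.reindex_bij_witness[of _ "\<lambda>t. a + t" "\<lambda>t. t - a"]) auto
  finally show ?thesis .
qed

text \<open>Left multiplication by \<open>A\<close> commutes with right multiplication by complex
  numbers, so it is a complex linear map in 2n coordinates. An eigenvector of that map is a right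
  eigenvector of \<open>A\<close> with a complex eigenvalue.\<close>

lemma quat_complex_eigenvector:
  fixes A :: "quat mat"
  assumes A: "A \<in> carrier_mat n n" and n: "n > 0"
  obtains x \<mu> where "x \<in> carrier_vec n" "x \<noteq> 0\<^sub>v n"
    "A *\<^sub>v x = rsmult_vec x (quat_of_complex \<mu> 0)"
proof -
  \<comment> \<open>The blocks are the coefficients in \<open>cu_mult\<close> and
    \<open>cv_mult\<close>: the upper half of the coordinates holds the \<open>cu\<close> parts of a
    vector, the lower half its \<open>cv\<close> parts.\<close>
  define M where "M = mat (n + n) (n + n) (\<lambda>(i, j).
    if i < n then if j < n then cu (A $$ (i, j)) else - cnj (cv (A $$ (i, j - n)))
    else if j < n then cv (A $$ (i - n, j)) else cnj (cu (A $$ (i - n, j - n))))"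
  have M: "M \<in> carrier_mat (n + n) (n + n)" by (simp add: M_def)
  obtain \<mu> w where w: "w \<in> carrier_vec (n + n)" "w \<noteq> 0\<^sub>v (n + n)" and Mw: "M *\<^sub>v w = \<mu> \<cdot>\<^sub>v w"
    using spectrum_non_empty[OF M] n M
    by (auto simp: spectrum_def eigenvalue_def eigenvector_def)
  define x where "x = vec n (\<lambda>i. quat_of_complex (w $ i) (w $ (n + i)))"
  have x: "x \<in> carrier_vec n" by (simp add: x_def)
  have x0: "x \<noteq> 0\<^sub>v n"
  proof
    assume *: "x = 0\<^sub>v n"
    have "quat_of_complex (w $ i) (w $ (n + i)) = 0" if "i < n" for i
      using that arg_cong[OF *, of "\<lambda>v. v $ i"] by (simp add: x_def)
    then have "w $ i = 0 \<and> w $ (n + i) = 0" if "i < n" for i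
      using that by (auto simp: quat_of_complex_def zero_quat_def complex_eq_iff)
    then have "w $ i = 0" if "i < n + n" for i
      using that by (metis le_add_diff_inverse nat_add_left_cancel_less not_le)
    with w show False by auto
  qed
  have ev: "(\<Sum>t<n. M $$ (i, t) * w $ t) + (\<Sum>t<n. M $$ (i, n + t) * w $ (n + t)) = \<mu> * w $ i"
    if "i < n + n" for i
    using that index_mult_mat_vec_sum[OF M w(1) that] w
    unfolding Mw sum_lessThan_add by simp
  have "(A *\<^sub>v x) $ i = x $ i * quat_of_complex \<mu> 0" if i: "i < n" for i
  proof (rule quat_eqI_complex)
    have Ax: "(A *\<^sub>v x) $ i = (\<Sum>t<n. A $$ (i, t) * x $ t)"
      using A x i by (rule index_mult_mat_vec_sum)
    show "cu ((A *\<^sub>v x) $ i) = cu (x $ i * quat_of_complex \<mu> 0)"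
      using ev[of i] i unfolding Ax
      by (simp add: cu_sum cu_mult x_def M_def sum_subtractf sum_negf mult.commute)
    show "cv ((A *\<^sub>v x) $ i) = cv (x $ i * quat_of_complex \<mu> 0)"
      using ev[of "n + i"] i unfolding Ax
      by (simp add: cv_sum cv_mult x_def M_def sum.distrib mult.commute add.commute)
  qed
  then have "A *\<^sub>v x = rsmult_vec x (quat_of_complex \<mu> 0)"
    using A x by (intro eq_vecI) (auto simp: rsmult_vec_def simp del: index_mult_mat_vec)
  with x x0 show ?thesis by (rule that)
qed

lemma sum_qsq_pos:
  assumes "x \<in> carrier_vec n" "x \<noteq> 0\<^sub>v n"
  shows "(\<Sum>i<n. qsq (x $ i)) > 0"
proof -
  obtain i where "i < n" "x $ i \<noteq> 0" using assms by (metis eq_vecI carrier_vecD index_zero_vec)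
  then show ?thesis by (intro sum_pos2[of _ i]) (auto simp: less_le dest: sym)
qed

text \<open>For a right eigenvector with eigenvalue \<open>q\<close>, the scalar x* A x equals |x|^2
  q. It is self-adjoint because \<open>A\<close> is Hermitian, so \<open>q\<close> is self-adjoint
  and hence real. A real eigenvalue may stand on either side of \<open>x\<close>, whence the scaling
  by a real.\<close>

lemma quat_hermitian_eigenvector:
  fixes A :: "quat mat"
  assumes A: "A \<in> carrier_mat n n" and n: "n > 0" and herm: "hermitian_mat A"
  obtains x c where "x \<in> carrier_vec n" "x \<noteq> 0\<^sub>v n"
    "\<And>i. i < n \<Longrightarrow> (\<Sum>t<n. A $$ (i, t) * x $ t) = c *\<^sub>R x $ i"
proof -
  obtain x \<mu> where x: "x \<in> carrier_vec n" "x \<noteq> 0\<^sub>v n"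
    and Ax: "A *\<^sub>v x = rsmult_vec x (quat_of_complex \<mu> 0)"
    using quat_complex_eigenvector[OF A n] .
  define q where "q = quat_of_complex \<mu> 0"
  have ev: "(\<Sum>t<n. A $$ (i, t) * x $ t) = x $ i * q" if "i < n" for i
    using index_mult_mat_vec_sum[OF A x(1) that] that x Ax by (simp add: rsmult_vec_def q_def)
  define N where "N = (\<Sum>i<n. qsq (x $ i))"
  have N: "N > 0" unfolding N_def using x by (rule sum_qsq_pos)
  define s where "s = (\<Sum>i<n. \<Sum>t<n. star (x $ i) * A $$ (i, t) * x $ t)"
  have "s = (\<Sum>i<n. star (x $ i) * (x $ i * q))"
    unfolding s_def by (intro sum.cong) (simp_all add: mult.assoc flip: sum_distrib_left, simp add: ev)
  also have "\<dots> = of_real N * q"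
    by (simp add: N_def sum_distrib_right star_mult_self flip: mult.assoc)
  finally have sN: "s = N *\<^sub>R q" by (simp add: of_real_def)
  have "star s = (\<Sum>i<n. \<Sum>t<n. star (x $ t) * A $$ (t, i) * x $ i)"
    unfolding s_def using hermitian_index[OF herm A] by (simp add: star_sum mult.assoc)
  also have "\<dots> = s" unfolding s_def by (rule sum.swap)
  finally have "N *\<^sub>R star q = N *\<^sub>R q" unfolding sN by simp
  then have "star q = q" using N by simp
  then have q: "q = of_real (QRe q)" by (rule quat_self_adjoint_real)
  have "(\<Sum>t<n. A $$ (i, t) * x $ t) = QRe q *\<^sub>R x $ i" if "i < n" for i
    using ev[OF that] by (subst (asm) q) (simp add: of_real_def)
  with x show ?thesis by (rule that)
qed

text \<open>As the eigenvalue is real, an eigenvector stays one after right multiplication by any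
  nonzero quaternion. This freedom is used to give the vector length 1 and the first entry required
  by \<open>householder\<close>.\<close>

lemma unit_eigenvector:
  fixes A :: "quat mat"
  assumes A: "A \<in> carrier_mat n n" and n: "n > 0" and herm: "hermitian_mat A"
  obtains x c a where "x \<in> carrier_vec n" "(\<Sum>i<n. qsq (x $ i)) = 1" "x $ 0 = of_real a" "a \<le> 0"
    "\<And>i. i < n \<Longrightarrow> (\<Sum>t<n. A $$ (i, t) * x $ t) = c *\<^sub>R x $ i"
proof -
  obtain x c where x: "x \<in> carrier_vec n" "x \<noteq> 0\<^sub>v n"
    and ev: "\<And>i. i < n \<Longrightarrow> (\<Sum>t<n. A $$ (i, t) * x $ t) = c *\<^sub>R x $ i"
    using quat_hermitian_eigenvector[OF A n herm] by blast
  define N where "N = (\<Sum>i<n. qsq (x $ i))"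
  have N: "N > 0" unfolding N_def using x by (rule sum_qsq_pos)
  \<comment> \<open>A unit quaternion that turns the first entry into minus its modulus; if that
    entry is 0, any unit will do.\<close>
  define w where "w = (if x $ 0 = 0 then 1 else (- 1 / sqrt (qsq (x $ 0))) *\<^sub>R star (x $ 0))"
  define a where "a = - sqrt (qsq (x $ 0)) / sqrt N"
  have qsq_scale: "qsq (r *\<^sub>R y) = r\<^sup>2 * qsq y" for r y
    by (simp add: qsq_def scaleR_quat_def power_mult_distrib algebra_simps)
  have qsq_minus: "qsq (- y) = qsq y" for y
    by (simp add: qsq_def uminus_quat_def)
  have qsq_mult: "qsq (y * z) = qsq y * qsq z" for y z
    by (simp add: qsq_def times_quat_def power2_eq_square algebra_simps)
  have w: "qsq w = 1"
    by (auto simp: w_def qsq_minus qsq_scale power_divide) (simp add: qsq_def one_quat_def)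
  have x0: "x $ 0 * w = (- sqrt (qsq (x $ 0))) *\<^sub>R 1"
    by (auto simp: w_def mult_star_self of_real_def real_div_sqrt)
  define y where "y = vec n (\<lambda>i. (1 / sqrt N) *\<^sub>R (x $ i * w))"
  have y: "y \<in> carrier_vec n" by (simp add: y_def)
  have "(\<Sum>i<n. qsq (y $ i)) = (\<Sum>i<n. (1 / N) * qsq (x $ i))"
    using N by (intro sum.cong) (auto simp: y_def qsq_scale qsq_mult w power_divide)
  also have "\<dots> = 1" using N by (simp only: flip: sum_distrib_left) (simp flip: N_def)
  finally have y1: "(\<Sum>i<n. qsq (y $ i)) = 1" .
  have y0: "y $ 0 = of_real a"
    using n x0 by (simp add: y_def of_real_def a_def)
  have "(\<Sum>t<n. A $$ (i, t) * y $ t) = c *\<^sub>R y $ i" if i: "i < n" for i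
  proof -
    have "(\<Sum>t<n. A $$ (i, t) * y $ t) = (1 / sqrt N) *\<^sub>R ((\<Sum>t<n. A $$ (i, t) * x $ t) * w)"
      by (simp add: y_def sum_distrib_right scaleR_sum_right mult.assoc)
    then show ?thesis using i by (simp add: ev y_def)
  qed
  moreover have "a \<le> 0" using N by (simp add: a_def)
  ultimately show ?thesis using that y y1 y0 by blast
qed

section \<open>The spectral theorem for quaternion Hermitian matrices\<close>

text \<open>The Householder reflection \<open>H\<close> exchanging the first unit vector and \<open>x\<close>; as the first entry
  of \<open>x\<close> is a nonpositive real, the denominator \<open>1 - a\<close> does not vanish.\<close>

lemma householder:
  assumes x: "x \<in> carrier_vec n" and n: "n > 0" and unit: "(\<Sum>i<n. qsq (x $ i)) = 1"
    and x0: "x $ 0 = of_real a" and a: "a \<le> 0"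
  obtains H where "H \<in> carrier_mat n n" "hermitian_mat H" "H * H = 1\<^sub>m n"
    "\<And>i. i < n \<Longrightarrow> H $$ (i, 0) = x $ i"
proof -
  define v where "v i = x $ i - (if i = 0 then 1 else 0)" for i
  \<comment> \<open>The reflection along \<open>v\<close> is 1 - (2 / |v|^2) v v*, and |v|^2 = 2 -
    2a by \<open>vv\<close> below, so the factor is \<open>1 / (1 - a)\<close>.\<close>
  define b where "b = 1 / (1 - a)"
  have a1: "1 - a \<noteq> 0" using a by simp
  have v0: "v 0 = of_real (a - 1)" using x0 by (simp add: v_def)
  have qv: "qsq (v i) = qsq (x $ i) + (if i = 0 then 1 - 2 * a else 0)" for i
    by (auto simp: v_def x0 qsq_def quat_defs of_real_quat power2_eq_square algebra_simps)
  have vv: "(\<Sum>i<n. qsq (v i)) = 2 - 2 * a"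
    using n unit by (simp add: qv sum.distrib)
  define H where "H = mat n n (\<lambda>(i, j). (if i = j then 1 else 0) - b *\<^sub>R (v i * star (v j)))"
  have H: "H \<in> carrier_mat n n" by (simp add: H_def)
  have "hermitian_mat H"
    unfolding hermitian_mat_def by (rule eq_matI) (auto simp: H_def)
  moreover have "H * H = 1\<^sub>m n"
  proof (rule eq_matI)
    fix i j
    assume "i < dim_row (1\<^sub>m n :: quat mat)" "j < dim_col (1\<^sub>m n :: quat mat)"
    then have i: "i < n" and j: "j < n" by auto
    have "(H * H) $$ (i, j) = (\<Sum>t<n. H $$ (i, t) * H $$ (t, j))"
      using H H i j by (rule index_mult_mat_sum)
    also have "\<dots> = (\<Sum>t<n. (if t = i then (if i = j then 1 else 0) - b *\<^sub>R (v i * star (v j)) else 0)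
        - (if t = j then b *\<^sub>R (v i * star (v j)) else 0)
        + (b * b) *\<^sub>R (v i * (star (v t) * v t) * star (v j)))"
      using i j by (intro sum.cong) (auto simp: H_def algebra_simps)
    also have "\<dots> = (if i = j then 1 else 0) - b *\<^sub>R (v i * star (v j)) - b *\<^sub>R (v i * star (v j))
        + (b * b) *\<^sub>R (v i * (\<Sum>t<n. star (v t) * v t) * star (v j))"
      using i j by (simp add: sum.distrib sum_subtractf scaleR_sum_right sum_distrib_left sum_distrib_right)
    also have "(\<Sum>t<n. star (v t) * v t) = of_real (2 - 2 * a)"
      by (simp only: star_mult_self vv flip: of_real_sum)
    also have "(b * b) *\<^sub>R (v i * of_real (2 - 2 * a) * star (v j)) = (b * (b * (2 - 2 * a))) *\<^sub>R (v i * star (v j))"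
      by (simp add: of_real_def algebra_simps)
    also have "b * (2 - 2 * a) = 2" using a1 by (simp add: b_def field_simps)
    finally show "(H * H) $$ (i, j) = (1\<^sub>m n :: quat mat) $$ (i, j)"
      using i j by (simp add: scaleR_2[symmetric] algebra_simps del: index_mult_mat(1))
  qed (use H in auto)
  moreover have "H $$ (i, 0) = x $ i" if "i < n" for i
  proof -
    have "H $$ (i, 0) = (if i = 0 then 1 else 0) - (b * (a - 1)) *\<^sub>R v i"
      using that n by (simp add: H_def v0 star_of_real del: of_real_diff) (simp add: of_real_def)
    also have "b * (a - 1) = - 1" using a1 by (simp add: b_def field_simps)
    finally show ?thesis by (simp add: v_def)
  qed
  ultimately show ?thesis using that H by blast
qed

text \<open>Induction on the size. A reflection whose first column is a unit eigenvector splits off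
  one real eigenvalue and leaves a Hermitian block of size \<open>m\<close>.\<close>

lemma quat_spectral_theorem:
  fixes A :: "quat mat"
  assumes "A \<in> carrier_mat n n" "hermitian_mat A"
  shows "\<exists>V d. V \<in> carrier_mat n n \<and> unitary_mat V \<and>
    conj_transpose V * A * V = mat_diag n (\<lambda>p. of_real (d p))"
  using assms
proof (induction n arbitrary: A)
  case 0
  then show ?case
    by (intro exI[of _ "1\<^sub>m 0"] exI[of _ "\<lambda>_. 0"]) (auto simp: unitary_mat_def mat_diag_def intro!: eq_matI)
next
  case (Suc m)
  let ?n = "Suc m"
  note A = Suc.prems(1)
  obtain x c a where x: "x \<in> carrier_vec ?n" "(\<Sum>i<?n. qsq (x $ i)) = 1" "x $ 0 = of_real a" "a \<le> 0"
    and ev: "\<And>i. i < ?n \<Longrightarrow> (\<Sum>t<?n. A $$ (i, t) * x $ t) = c *\<^sub>R x $ i"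
    by (rule unit_eigenvector[OF A zero_less_Suc Suc.prems(2)]) (rule that)
  obtain H where H: "H \<in> carrier_mat ?n ?n" "hermitian_mat H" "H * H = 1\<^sub>m ?n"
    and H0: "\<And>i. i < ?n \<Longrightarrow> H $$ (i, 0) = x $ i"
    by (rule householder[OF x(1) zero_less_Suc x(2-4)]) (rule that)
  have HH: "conj_transpose H = H" using H(2) by (simp add: hermitian_mat_def)
  have Hu: "unitary_mat H" using H by (simp add: unitary_mat_iff HH)
  define B where "B = conj_transpose H * A * H"
  have B: "B \<in> carrier_mat ?n ?n"
    unfolding B_def by (intro mult_carrier_mat[of _ ?n ?n _ ?n] conj_transpose_carrier A H(1))
  have Bh: "hermitian_mat B" unfolding B_def using A H(1) Suc.prems(2) by (rule hermitian_congruence)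
  have AH: "(A * H) $$ (i, 0) = c *\<^sub>R H $$ (i, 0)" if "i < ?n" for i
    using index_mult_mat_sum[OF A H(1) that zero_less_Suc] ev[OF that] H0 that by simp
  \<comment> \<open>The first column of \<open>A * H\<close> is \<open>c\<close> times that of
    \<open>H\<close>, and \<open>H\<close> is its own inverse, so the first column of
    \<open>B\<close> is \<open>c\<close> times the first unit vector.\<close>
  have B0: "B $$ (i, 0) = (if i = 0 then of_real c else 0)" if i: "i < ?n" for i
  proof -
    have "B = H * (A * H)" using A H by (simp add: B_def HH)
    then have "B $$ (i, 0) = (\<Sum>t<?n. H $$ (i, t) * (A * H) $$ (t, 0))"
      using index_mult_mat_sum[OF H(1) mult_carrier_mat[OF A H(1)] i zero_less_Suc] by simp
    also have "\<dots> = c *\<^sub>R (\<Sum>t<?n. H $$ (i, t) * H $$ (t, 0))"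
      unfolding scaleR_sum_right by (intro sum.cong) (simp_all add: AH del: index_mult_mat(1))
    also have "(\<Sum>t<?n. H $$ (i, t) * H $$ (t, 0)) = (H * H) $$ (i, 0)"
      using index_mult_mat_sum[OF H(1) H(1) i zero_less_Suc] by simp
    also have "c *\<^sub>R \<dots> = (if i = 0 then of_real c else 0)"
      using i by (simp add: H(3) of_real_def)
    finally show ?thesis .
  qed
  define B' where "B' = mat m m (\<lambda>(i, j). B $$ (Suc i, Suc j))"
  have B': "B' \<in> carrier_mat m m" by (simp add: B'_def)
  have "hermitian_mat B'"
    unfolding hermitian_mat_def using hermitian_index[OF Bh B]
    by (intro eq_matI) (auto simp: B'_def)
  then obtain V d where V: "V \<in> carrier_mat m m" "unitary_mat V"
    and Vd: "conj_transpose V * B' * V = mat_diag m (\<lambda>p. of_real (d p))"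
    using Suc.IH[OF B'] by blast
  let ?blk = "\<lambda>E F. four_block_mat E (0\<^sub>m (Suc 0) m) (0\<^sub>m m (Suc 0)) F :: quat mat"
  define L where "L = mat (Suc 0) (Suc 0) (\<lambda>_. of_real c :: quat)"
  define W where "W = ?blk (1\<^sub>m (Suc 0)) V"
  have W: "W \<in> carrier_mat ?n ?n" using V unfolding W_def by (intro carrier_matI) auto
  \<comment> \<open>Hermitian symmetry carries the zeros of the first column over to the first
    row.\<close>
  have B_row: "B $$ (0, j) = (if j = 0 then of_real c else 0)" if "j < ?n" for j
    using hermitian_index[OF Bh B that zero_less_Suc] B0[OF that] by (auto split: if_splits)
  have Bblk: "B = ?blk L B'"
    using B B0 B_row by (intro eq_matI) (auto simp: B'_def L_def)
  have Wc: "conj_transpose W = ?blk (1\<^sub>m (Suc 0)) (conj_transpose V)"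
    using V by (intro eq_matI) (auto simp: W_def)
  have blk_mult: "?blk E F * ?blk E' F' = ?blk (E * E') (F * F')"
    if "E \<in> carrier_mat (Suc 0) (Suc 0)" "E' \<in> carrier_mat (Suc 0) (Suc 0)" "F \<in> carrier_mat m m" "F' \<in> carrier_mat m m"
    for E E' F F'
    using that by (subst mult_four_block_mat[where ?nr1.0="Suc 0" and ?n1.0="Suc 0" and ?n2.0=m
          and ?nr2.0=m and ?nc1.0="Suc 0" and ?nc2.0=m]) auto
  have L: "L \<in> carrier_mat (Suc 0) (Suc 0)" by (simp add: L_def)
  have Wu: "unitary_mat W"
    using V W unfolding unitary_mat_iff[OF W] Wc by (simp add: W_def blk_mult unitary_mat_iff)
  have "conj_transpose W * B * W = ?blk L (conj_transpose V * B' * V)"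
    using V B' L unfolding Wc Bblk unfolding W_def
    by (simp add: blk_mult mult_carrier_mat[of _ m m _ m])
  also have "\<dots> = mat_diag ?n (\<lambda>p. of_real (case p of 0 \<Rightarrow> c | Suc q \<Rightarrow> d q))"
    unfolding Vd by (rule eq_matI) (auto simp: L_def mat_diag_def split: nat.splits)
  finally have "conj_transpose (H * W) * A * (H * W)
      = mat_diag ?n (\<lambda>p. of_real (case p of 0 \<Rightarrow> c | Suc q \<Rightarrow> d q))"
    using congruence_mult[OF A H(1) W] by (simp add: B_def)
  moreover have "unitary_mat (H * W)" using H(1) W Hu Wu by (rule unitary_mult)
  moreover have "H * W \<in> carrier_mat ?n ?n" using H W by simp
  ultimately show ?case by blast
qed

section \<open>Dual quaternion matrices\<close>

definition dual_mat :: "'a::ring_1 mat \<Rightarrow> 'a mat \<Rightarrow> 'a dual mat" where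
  "dual_mat X Y = mat (dim_row X) (dim_col X) (\<lambda>ij. Dual (X $$ ij) (Y $$ ij))"

lemma dual_mat_carrier [simp]: "X \<in> carrier_mat a b \<Longrightarrow> dual_mat X Y \<in> carrier_mat a b"
  by (auto simp: dual_mat_def)

lemma index_dual_mat [simp]:
  "i < dim_row X \<Longrightarrow> j < dim_col X \<Longrightarrow> dual_mat X Y $$ (i, j) = Dual (X $$ (i, j)) (Y $$ (i, j))"
  "dim_row (dual_mat X Y) = dim_row X" "dim_col (dual_mat X Y) = dim_col X"
  by (auto simp: dual_mat_def)

lemma dual_mat_parts: "dual_mat (map_mat std_part A) (map_mat inf_part A) = A"
  by (rule eq_matI) auto

lemma dual_mat_eq_iff:
  assumes "X \<in> carrier_mat a b" "Y \<in> carrier_mat a b" "X' \<in> carrier_mat a b" "Y' \<in> carrier_mat a b"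
  shows "dual_mat X Y = dual_mat X' Y' \<longleftrightarrow> X = X' \<and> Y = Y'"
  using assms by (auto simp: mat_eq_iff)

lemma std_part_sum: "std_part (\<Sum>i\<in>I. f i) = (\<Sum>i\<in>I. std_part (f i))"
  and inf_part_sum: "inf_part (\<Sum>i\<in>I. f i) = (\<Sum>i\<in>I. inf_part (f i))"
  by (induction I rule: infinite_finite_induct; simp add: dual_defs)+

lemma map_std_part_mult:
  assumes "A \<in> carrier_mat a b" "B \<in> carrier_mat b c"
  shows "map_mat std_part (A * B) = map_mat std_part A * map_mat std_part B"
  using assms
  by (intro eq_matI)
    (auto simp: index_mult_mat_sum[of _ a b _ c] std_part_sum dual_defs simp del: index_mult_mat(1))

lemma map_std_part_conj_transpose:
  "map_mat std_part (conj_transpose A) = conj_transpose (map_mat std_part A)"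
  by (rule eq_matI) (auto simp: star_dual_def)

lemma dual_mat_mult:
  assumes "X \<in> carrier_mat a b" "Y \<in> carrier_mat a b" "X' \<in> carrier_mat b c" "Y' \<in> carrier_mat b c"
  shows "dual_mat X Y * dual_mat X' Y' = dual_mat (X * X') (X * Y' + Y * X')"
proof (rule eq_matI)
  fix i j
  assume "i < dim_row (dual_mat (X * X') (X * Y' + Y * X'))"
    "j < dim_col (dual_mat (X * X') (X * Y' + Y * X'))"
  then have i: "i < a" and j: "j < c" using assms by auto
  have "(dual_mat X Y * dual_mat X' Y') $$ (i, j) = (\<Sum>t<b. dual_mat X Y $$ (i, t) * dual_mat X' Y' $$ (t, j))"
    using assms i j by (intro index_mult_mat_sum[of _ a b _ c]) auto
  also have "\<dots> = Dual ((X * X') $$ (i, j)) ((X * Y') $$ (i, j) + (Y * X') $$ (i, j))"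
    using assms i j
    by (intro dual.expand)
      (simp add: std_part_sum inf_part_sum dual_defs sum.distrib index_mult_mat_sum[of _ a b _ c]
        del: index_mult_mat(1))
  also have "\<dots> = dual_mat (X * X') (X * Y' + Y * X') $$ (i, j)"
    using assms i j by (simp del: index_mult_mat(1))
  finally show "(dual_mat X Y * dual_mat X' Y') $$ (i, j) = dual_mat (X * X') (X * Y' + Y * X') $$ (i, j)" .
qed (use assms in auto)

lemma conj_transpose_dual_mat:
  assumes "X \<in> carrier_mat a b" "Y \<in> carrier_mat a b"
  shows "conj_transpose (dual_mat X Y) = dual_mat (conj_transpose X) (conj_transpose Y)"
  using assms by (intro eq_matI) (auto simp: star_dual_def)

lemma dual_mat_one: "dual_mat (1\<^sub>m n) (0\<^sub>m n n) = 1\<^sub>m n"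
  by (rule eq_matI) (auto simp: dual_defs)

lemma hermitian_dual_mat:
  fixes X Y :: "'a::star_ring mat"
  assumes "X \<in> carrier_mat n n" "Y \<in> carrier_mat n n"
  shows "hermitian_mat (dual_mat X Y) \<longleftrightarrow> hermitian_mat X \<and> hermitian_mat Y"
  using assms unfolding hermitian_mat_def
  by (simp add: conj_transpose_dual_mat dual_mat_eq_iff[of _ n n])

text \<open>The second condition is the vanishing of the infinitesimal part of U* U. In particular
  the standard part of a unitary matrix is unitary.\<close>

lemma unitary_dual_mat:
  fixes X Y :: "'a::star_ring mat"
  assumes "X \<in> carrier_mat n n" "Y \<in> carrier_mat n n"
  shows "unitary_mat (dual_mat X Y) \<longleftrightarrow>
    unitary_mat X \<and> conj_transpose X * Y + conj_transpose Y * X = 0\<^sub>m n n"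
proof -
  have "conj_transpose (dual_mat X Y) * dual_mat X Y
      = dual_mat (conj_transpose X * X) (conj_transpose X * Y + conj_transpose Y * X)"
    using assms by (simp add: conj_transpose_dual_mat dual_mat_mult[of _ n n _ _ n])
  then show ?thesis
    using assms
    by (simp add: unitary_mat_iff[of _ n] dual_mat_eq_iff[of _ n n] mult_carrier_mat[of _ n n _ n]
        flip: dual_mat_one)
qed

text \<open>By the quaternion case, U U* has standard part 1, so it is 1 + N epsilon. It is also
  idempotent, and its square is 1 + 2N epsilon, so N = 0.\<close>

lemma dual_unitary_right_inverse:
  assumes U: "U \<in> carrier_mat n n" and uni: "unitary_mat (U :: quat dual mat)"
  shows "U * conj_transpose U = 1\<^sub>m n"
proof -
  define V Q where "V = map_mat std_part U" and "Q = map_mat inf_part U"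
  have V: "V \<in> carrier_mat n n" and Q: "Q \<in> carrier_mat n n" using U by (simp_all add: V_def Q_def)
  have UVQ: "U = dual_mat V Q" by (simp add: V_def Q_def dual_mat_parts)
  have "unitary_mat V" using uni V Q by (simp add: UVQ unitary_dual_mat)
  then have VV: "V * conj_transpose V = 1\<^sub>m n" using V by (intro quat_unitary_right_inverse)
  define C where "C = conj_transpose U"
  define N where "N = V * conj_transpose Q + Q * conj_transpose V"
  have N: "N \<in> carrier_mat n n" using V Q by (simp add: N_def)
  have C: "C \<in> carrier_mat n n" using U by (simp add: C_def)
  have UC: "U * C = dual_mat (1\<^sub>m n) N"
    using V Q by (simp add: C_def UVQ conj_transpose_dual_mat dual_mat_mult[of _ n n _ _ n] N_def VV)
  have "(U * C) * (U * C) = U * ((C * U) * C)"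
    using U C by (simp add: assoc_mult_mat[of _ n n _ n _ n] mult_carrier_mat[of _ n n _ n])
  also have "\<dots> = U * C" using U C uni by (simp add: unitary_mat_iff C_def)
  finally have "dual_mat (1\<^sub>m n) (N + N) = dual_mat (1\<^sub>m n) N"
    unfolding UC using N by (simp add: dual_mat_mult[of _ n n _ _ n])
  then have "N + N = N" using N by (simp add: dual_mat_eq_iff[of _ n n])
  then have "N $$ (i, j) + N $$ (i, j) = N $$ (i, j)" if "i < n" "j < n" for i j
    using that N by (metis carrier_matD index_add_mat(1))
  then have "N = 0\<^sub>m n n" using N by (intro eq_matI) auto
  then show ?thesis using UC by (simp add: C_def dual_mat_one)
qed

section \<open>Diagonalization\<close>

text \<open>The right inverse is assumed separately because it does not follow from unitarity over
  every star ring; for quaternions and dual quaternions it is supplied by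
  \<open>quat_unitary_right_inverse\<close> and \<open>dual_unitary_right_inverse\<close>.\<close>

lemma congruence_eq_iff:
  fixes A U :: "'a::star_ring mat"
  assumes "A \<in> carrier_mat n n" "U \<in> carrier_mat n n" "S \<in> carrier_mat n n"
    and "unitary_mat U" "U * conj_transpose U = 1\<^sub>m n"
  shows "conj_transpose U * A * U = S \<longleftrightarrow> A * U = U * S"
proof
  assume "conj_transpose U * A * U = S"
  then have "U * S = (U * conj_transpose U) * (A * U)"
    using assms(1,2) by (auto simp: assoc_mult_mat[of _ n n _ n _ n] mult_carrier_mat[of _ n n _ n])
  then show "A * U = U * S" using assms by simp
next
  assume "A * U = U * S"
  then have "conj_transpose U * A * U = (conj_transpose U * U) * S"
    using assms(1-3) by (simp add: assoc_mult_mat[of _ n n _ n _ n])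
  then show "conj_transpose U * A * U = S" using assms by (simp add: unitary_mat_iff)
qed

text \<open>Column \<open>q\<close> of \<open>V\<close> is an eigenvector for \<open>f q\<close>.
  The equivalence serves both to read eigenvectors off a diagonalization and to verify one
  entrywise.\<close>

lemma quat_diagonalizes_iff:
  fixes A V :: "quat mat"
  assumes A: "A \<in> carrier_mat n n" and V: "V \<in> carrier_mat n n" "unitary_mat V"
  shows "conj_transpose V * A * V = mat_diag n (\<lambda>p. of_real (f p)) \<longleftrightarrow>
    (\<forall>i<n. \<forall>q<n. (\<Sum>t<n. A $$ (i, t) * V $$ (t, q)) = f q *\<^sub>R V $$ (i, q))"
proof -
  have "A * V = V * mat_diag n (\<lambda>p. of_real (f p)) \<longleftrightarrow>
    (\<forall>i<n. \<forall>q<n. (A * V) $$ (i, q) = V $$ (i, q) * of_real (f q))"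
    using A V by (auto simp: mat_eq_iff mat_diag_mult_right[of _ n n] simp del: index_mult_mat(1))
  then show ?thesis
    using A V quat_unitary_right_inverse[OF V]
    by (simp add: congruence_eq_iff index_mult_mat_sum[of _ n n _ n] of_real_def del: index_mult_mat(1))
qed

text \<open>In the coordinates z = S* y the eigenvalue equation becomes b_p z_p = c z_p for every p,
  and some z_p is nonzero.\<close>

lemma quat_eigenvalue_in_spectrum:
  fixes B S :: "quat mat"
  assumes B: "B \<in> carrier_mat n n" and S: "S \<in> carrier_mat n n" "unitary_mat S"
    and diag: "conj_transpose S * B * S = mat_diag n (\<lambda>p. of_real (b p))"
    and y: "y \<in> carrier_vec n" "y \<noteq> 0\<^sub>v n"
    and ev: "\<And>i. i < n \<Longrightarrow> (\<Sum>t<n. B $$ (i, t) * y $ t) = c *\<^sub>R y $ i"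
  shows "c \<in> b ` {..<n}"
proof -
  define C where "C = conj_transpose S"
  define z where "z = C *\<^sub>v y"
  have C: "C \<in> carrier_mat n n" using S by (simp add: C_def)
  have SC: "S * C = 1\<^sub>m n" unfolding C_def using S by (rule quat_unitary_right_inverse)
  have z: "z \<in> carrier_vec n" using C y by (simp add: z_def)
  have Sz: "S *\<^sub>v z = y"
    using S C y SC by (simp add: z_def flip: assoc_mult_mat_vec[of _ n n _ n])
  have "z \<noteq> 0\<^sub>v n"
  proof
    assume "z = 0\<^sub>v n"
    then have "y = 0\<^sub>v n" using Sz S by (auto intro!: eq_vecI simp: scalar_prod_def)
    with y show False by simp
  qed
  then obtain p where p: "p < n" "z $ p \<noteq> 0" using z by (metis eq_vecI carrier_vecD index_zero_vec)
  have "mat_diag n (\<lambda>p. of_real (b p)) *\<^sub>v z = C *\<^sub>v (B *\<^sub>v (S *\<^sub>v z))"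
    using B C S z unfolding diag[symmetric] C_def[symmetric]
    by (simp add: assoc_mult_mat_vec[of _ n n _ n] mult_carrier_mat[of _ n n _ n] mult_mat_vec_carrier[of _ n n])
  also have "B *\<^sub>v (S *\<^sub>v z) = vec n (\<lambda>i. c *\<^sub>R y $ i)"
    unfolding Sz using B y by (intro eq_vecI) (auto simp: ev index_mult_mat_vec_sum simp del: index_mult_mat_vec)
  finally have eq: "mat_diag n (\<lambda>p. of_real (b p)) *\<^sub>v z = C *\<^sub>v vec n (\<lambda>i. c *\<^sub>R y $ i)" .
  have "(mat_diag n (\<lambda>p. of_real (b p)) *\<^sub>v z) $ p = b p *\<^sub>R z $ p"
    using index_mult_mat_vec_sum[OF mat_diag_dim z p(1), of "\<lambda>p. of_real (b p)"] p(1)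
    by (simp add: mat_diag_def of_real_def if_distrib[of "\<lambda>x. x * _"] cong: if_cong)
  moreover have "(C *\<^sub>v vec n (\<lambda>i. c *\<^sub>R y $ i)) $ p = c *\<^sub>R z $ p"
    using index_mult_mat_vec_sum[OF C _ p(1), of "vec n (\<lambda>i. c *\<^sub>R y $ i)"]
      index_mult_mat_vec_sum[OF C y(1) p(1)]
    by (simp add: z_def scaleR_sum_right)
  ultimately have "b p *\<^sub>R z $ p = c *\<^sub>R z $ p" using eq by metis
  then show ?thesis using p by (metis image_eqI lessThan_iff scaleR_right_imp_eq)
qed

text \<open>The eigenvalues of \<open>t D + B\<close> have the form \<open>t d\<^sub>i + b\<^sub>p\<close>. For all but finitely many \<open>t\<close> such a
  value determines \<open>d\<^sub>i\<close>, so that diagonalizing \<open>t D + B\<close> diagonalizes \<open>D\<close> and \<open>B\<close>.\<close>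

lemma simultaneous_diagonalization:
  fixes B :: "quat mat"
  defines "D d n \<equiv> mat_diag n (\<lambda>p. of_real (d p)) :: quat mat"
  assumes B: "B \<in> carrier_mat n n" "hermitian_mat B"
    and comm: "\<And>i j. i < n \<Longrightarrow> j < n \<Longrightarrow> d i \<noteq> d j \<Longrightarrow> B $$ (i, j) = 0"
  shows "\<exists>W e b. W \<in> carrier_mat n n \<and> unitary_mat W \<and>
    conj_transpose W * D d n * W = D e n \<and> conj_transpose W * B * W = D b n"
proof -
  obtain S \<beta> where S: "S \<in> carrier_mat n n" "unitary_mat S"
    and S\<beta>: "conj_transpose S * B * S = mat_diag n (\<lambda>p. of_real (\<beta> p))"
    using quat_spectral_theorem[OF B] by blast
  \<comment> \<open>The excluded values are those for which
    \<open>t * d i + \<beta> q = t * d j + \<beta> p\<close> can hold with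
    \<open>d i \<noteq> d j\<close>. Where \<open>d i = d j\<close>, division by zero gives 0, so
    such pairs exclude at most \<open>t = 0\<close>.\<close>
  have "finite ((\<lambda>(p, q, i, j). (\<beta> p - \<beta> q) / (d i - d j)) ` ({..<n} \<times> {..<n} \<times> {..<n} \<times> {..<n}))"
    by simp
  then obtain t where t: "t \<notin> (\<lambda>(p, q, i, j). (\<beta> p - \<beta> q) / (d i - d j)) ` ({..<n} \<times> {..<n} \<times> {..<n} \<times> {..<n})"
    using ex_new_if_finite[OF infinite_UNIV_char_0] by blast
  define C where "C = mat n n (\<lambda>(i, j). (if i = j then of_real (t * d i) else 0) + B $$ (i, j))"
  have C: "C \<in> carrier_mat n n" by (simp add: C_def)
  have "hermitian_mat C"
    unfolding hermitian_mat_def using hermitian_index[OF B(2,1)]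
    by (intro eq_matI) (auto simp: C_def simp del: of_real_mult)
  then obtain W c where W: "W \<in> carrier_mat n n" "unitary_mat W"
    and Wc: "conj_transpose W * C * W = mat_diag n (\<lambda>p. of_real (c p))"
    using quat_spectral_theorem[OF C] by blast
  have BW: "(\<Sum>k<n. B $$ (i, k) * W $$ (k, q)) = (c q - t * d i) *\<^sub>R W $$ (i, q)"
    if i: "i < n" and q: "q < n" for i q
  proof -
    have "c q *\<^sub>R W $$ (i, q) = (\<Sum>k<n. C $$ (i, k) * W $$ (k, q))"
      using Wc[unfolded quat_diagonalizes_iff[OF C W]] i q by simp
    also have "\<dots> = (\<Sum>k<n. (if k = i then of_real (t * d i) * W $$ (i, q) else 0) + B $$ (i, k) * W $$ (k, q))"
      using i by (intro sum.cong) (auto simp: C_def distrib_right)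
    also have "\<dots> = (t * d i) *\<^sub>R W $$ (i, q) + (\<Sum>k<n. B $$ (i, k) * W $$ (k, q))"
      using i by (simp add: sum.distrib of_real_def)
    finally show ?thesis by (simp add: scaleR_left_diff_distrib algebra_simps)
  qed
  have block: "c q - t * d i \<in> \<beta> ` {..<n}" if i: "i < n" and q: "q < n" and nz: "W $$ (i, q) \<noteq> 0" for i q
  proof (rule quat_eigenvalue_in_spectrum[OF B(1) S S\<beta>])
    \<comment> \<open>Column \<open>q\<close> restricted to the indices on which \<open>d\<close>
      takes the value \<open>d i\<close>. As \<open>B\<close> does not couple indices with different
      \<open>d\<close>, the restriction is an eigenvector of \<open>B\<close> for
      \<open>c q - t * d i\<close>.\<close>
    define y where "y = vec n (\<lambda>k. if d k = d i then W $$ (k, q) else 0)"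
    show "y \<in> carrier_vec n" by (simp add: y_def)
    show "y \<noteq> 0\<^sub>v n"
    proof
      assume "y = 0\<^sub>v n"
      then have "y $ i = 0" using i by simp
      with nz i show False by (simp add: y_def)
    qed
    show "(\<Sum>k<n. B $$ (j, k) * y $ k) = (c q - t * d i) *\<^sub>R y $ j" if j: "j < n" for j
    proof (cases "d j = d i")
      case True
      have "(\<Sum>k<n. B $$ (j, k) * y $ k) = (\<Sum>k<n. B $$ (j, k) * W $$ (k, q))"
        using True j comm by (intro sum.cong) (auto simp: y_def)
      with True show ?thesis using BW[OF j q] j by (simp add: y_def)
    next
      case False
      then have "(\<Sum>k<n. B $$ (j, k) * y $ k) = 0"
        using j comm by (intro sum.neutral) (auto simp: y_def)
      with False j show ?thesis by (simp add: y_def)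
    qed
  qed
  \<comment> \<open>Two nonzero entries of column \<open>q\<close> with different \<open>d\<close>
    would write \<open>c q\<close> in two ways as \<open>t * d i + \<beta> p\<close>, making
    \<open>t\<close> one of the excluded values.\<close>
  have same: "d i = d j" if ij: "i < n" "j < n" and q: "q < n" and nz: "W $$ (i, q) \<noteq> 0" "W $$ (j, q) \<noteq> 0" for i j q
  proof (rule ccontr)
    assume ne: "d i \<noteq> d j"
    obtain p p' where p: "p < n" "p' < n" "c q - t * d i = \<beta> p" "c q - t * d j = \<beta> p'"
      using block[OF ij(1) q nz(1)] block[OF ij(2) q nz(2)] by auto
    then have "t = (\<beta> p' - \<beta> p) / (d i - d j)" using ne by (simp add: field_simps)
    then have "t \<in> (\<lambda>(p, q, i, j). (\<beta> p - \<beta> q) / (d i - d j)) ` ({..<n} \<times> {..<n} \<times> {..<n} \<times> {..<n})"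
      using p ij by (intro image_eqI[of _ _ "(p', p, i, j)"]) auto
    with t show False ..
  qed
  \<comment> \<open>The common value of \<open>d\<close> on the support of column \<open>q\<close>;
    by \<open>same\<close> the choice of the index does not matter.\<close>
  define e where "e q = d (SOME i. i < n \<and> W $$ (i, q) \<noteq> 0)" for q
  have e: "d i = e q" if "i < n" "q < n" "W $$ (i, q) \<noteq> 0" for i q
  proof -
    have "(SOME i. i < n \<and> W $$ (i, q) \<noteq> 0) < n \<and> W $$ (SOME i. i < n \<and> W $$ (i, q) \<noteq> 0, q) \<noteq> 0"
      using that by (intro someI[of "\<lambda>i. i < n \<and> W $$ (i, q) \<noteq> 0"]) simp
    then show ?thesis unfolding e_def by (intro same[OF that(1) _ that(2,3)]) simp_all
  qed
  have "conj_transpose W * D d n * W = D e n"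
    unfolding D_def quat_diagonalizes_iff[OF mat_diag_dim W]
  proof (intro allI impI)
    fix i q assume i: "i < n" and q: "q < n"
    have "(\<Sum>k<n. mat_diag n (\<lambda>p. of_real (d p)) $$ (i, k) * W $$ (k, q)) =
      (\<Sum>k<n. if k = i then d i *\<^sub>R W $$ (i, q) else 0)"
      using i by (intro sum.cong) (auto simp: mat_diag_def of_real_def)
    also have "\<dots> = e q *\<^sub>R W $$ (i, q)" using i e[OF i q] by auto
    finally show "(\<Sum>k<n. mat_diag n (\<lambda>p. of_real (d p)) $$ (i, k) * W $$ (k, q)) = e q *\<^sub>R W $$ (i, q)" .
  qed
  \<comment> \<open>On the support of column \<open>q\<close>, \<open>BW\<close> applies with
    \<open>d i = e q\<close>; off the support \<open>BW\<close> makes both sides vanish.\<close>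
  moreover have "conj_transpose W * B * W = D (\<lambda>q. c q - t * e q) n"
    unfolding D_def quat_diagonalizes_iff[OF B(1) W]
  proof (intro allI impI)
    fix i q assume i: "i < n" and q: "q < n"
    show "(\<Sum>k<n. B $$ (i, k) * W $$ (k, q)) = (c q - t * e q) *\<^sub>R W $$ (i, q)"
      using BW[OF i q] e[OF i q] by (cases "W $$ (i, q) = 0") simp_all
  qed
  ultimately show ?thesis using W by blast
qed

section \<open>Unitary changes of basis for the infinitesimal part\<close>

lemma decouple_infinitesimal_part:
  fixes B :: "quat mat"
  defines "D d n \<equiv> mat_diag n (\<lambda>p. of_real (d p)) :: quat mat"
  assumes B: "B \<in> carrier_mat n n" "hermitian_mat B"
  shows "\<exists>U. U \<in> carrier_mat n n \<and> unitary_mat U \<and>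
    conj_transpose U * dual_mat (D d n) B * U
      = dual_mat (D d n) (mat n n (\<lambda>(i, j). if d i = d j then B $$ (i, j) else 0))"
proof -
  \<comment> \<open>The new infinitesimal entry at \<open>(i, j)\<close> is B_ij + (d_i - d_j) P_ij.
    Where the factor is nonzero, \<open>P\<close> is chosen to cancel B_ij; where it is zero,
    \<open>P\<close> has no influence and is set to 0. The sign change of \<open>d j - d i\<close>
    under transposition makes \<open>P\<close> skew-Hermitian.\<close>
  define P where "P = mat n n (\<lambda>(i, j). if d i = d j then 0 else (1 / (d j - d i)) *\<^sub>R B $$ (i, j))"
  have P: "P \<in> carrier_mat n n" by (simp add: P_def)
  have D: "D d n \<in> carrier_mat n n" by (simp add: D_def)
  have Pc: "conj_transpose P = - P"
    using hermitian_index[OF B(2,1)]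
    by (intro eq_matI) (auto simp: P_def minus_divide_right simp flip: scaleR_minus_left)
  define U where "U = dual_mat (1\<^sub>m n) P"
  have U: "U \<in> carrier_mat n n" by (simp add: U_def)
  have uni: "unitary_mat U"
    unfolding U_def unitary_dual_mat[OF one_carrier_mat P] Pc
    using P by (auto simp: unitary_mat_iff[of _ n] intro!: eq_matI)
  have "conj_transpose U * dual_mat (D d n) B * U = dual_mat (D d n) (D d n * P + (B + (- P) * D d n))"
    using P B D
    by (simp add: U_def conj_transpose_dual_mat[of _ n n] Pc dual_mat_mult[of _ n n _ _ n])
  also have "D d n * P + (B + (- P) * D d n) = mat n n (\<lambda>(i, j). if d i = d j then B $$ (i, j) else 0)"
  proof (rule eq_matI)
    fix i j
    assume "i < dim_row (mat n n (\<lambda>(i, j). if d i = d j then B $$ (i, j) else 0))"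
      "j < dim_col (mat n n (\<lambda>(i, j). if d i = d j then B $$ (i, j) else 0))"
    then have ij: "i < n" "j < n" by auto
    have "(D d n * P + (B + (- P) * D d n)) $$ (i, j)
        = d i *\<^sub>R P $$ (i, j) + (B $$ (i, j) - d j *\<^sub>R P $$ (i, j))"
      using ij P B unfolding D_def
      by (simp add: mat_diag_mult_left[of _ n n] mat_diag_mult_right[of _ n n] of_real_def)
    also have "\<dots> = B $$ (i, j) - (d j - d i) *\<^sub>R P $$ (i, j)" by (simp add: algebra_simps)
    also have "\<dots> = (if d i = d j then B $$ (i, j) else 0)" using ij by (simp add: P_def)
    finally show "(D d n * P + (B + (- P) * D d n)) $$ (i, j)
      = mat n n (\<lambda>(i, j). if d i = d j then B $$ (i, j) else 0) $$ (i, j)"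
      using ij by simp
  qed (use P B D in auto)
  finally show ?thesis using U uni by blast
qed

text \<open>Positions are numbered without blocks. Existence recovers the blocks after sorting, and
  uniqueness compares diagonals in this flat form.\<close>

definition real_dual_diag :: "nat \<Rightarrow> (nat \<Rightarrow> real) \<Rightarrow> (nat \<Rightarrow> real) \<Rightarrow> quat dual mat" where
  "real_dual_diag n d m = mat_diag n (\<lambda>p. Dual (of_real (d p)) (of_real (m p)))"

lemma dual_spectral_theorem:
  fixes A :: "quat dual mat"
  assumes A: "A \<in> carrier_mat n n" "hermitian_mat A"
  shows "\<exists>U d m. U \<in> carrier_mat n n \<and> unitary_mat U \<and>
    conj_transpose U * A * U = real_dual_diag n d m"
proof -
  define X Y where "X = map_mat std_part A" and "Y = map_mat inf_part A"
  have X: "X \<in> carrier_mat n n" and Y: "Y \<in> carrier_mat n n" using A by (simp_all add: X_def Y_def)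
  have AXY: "A = dual_mat X Y" by (simp add: X_def Y_def dual_mat_parts)
  then have herm: "hermitian_mat X" "hermitian_mat Y" using A X Y by (simp_all add: hermitian_dual_mat)
  \<comment> \<open>A quaternion unitary matrix with zero infinitesimal part acts on the standard
    and infinitesimal parts separately.\<close>
  have embed: "dual_mat V (0\<^sub>m n n) \<in> carrier_mat n n \<and> unitary_mat (dual_mat V (0\<^sub>m n n)) \<and>
      conj_transpose (dual_mat V (0\<^sub>m n n)) * dual_mat E F * dual_mat V (0\<^sub>m n n)
        = dual_mat (conj_transpose V * E * V) (conj_transpose V * F * V)"
    if "V \<in> carrier_mat n n" "unitary_mat V" "E \<in> carrier_mat n n" "F \<in> carrier_mat n n"
    for V E F :: "quat mat"
  proof -
    have [simp]: "conj_transpose (0\<^sub>m n n :: quat mat) = 0\<^sub>m n n" by (rule eq_matI) auto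
    show ?thesis using that
      by (simp add: conj_transpose_dual_mat[of _ n n] dual_mat_mult[of _ n n _ _ n] unitary_dual_mat
          mult_carrier_mat[of _ n n _ n])
  qed
  obtain V d where V: "V \<in> carrier_mat n n" "unitary_mat V"
    and Vd: "conj_transpose V * X * V = mat_diag n (\<lambda>p. of_real (d p))"
    using quat_spectral_theorem[OF X herm(1)] by blast
  let ?V = "dual_mat V (0\<^sub>m n n)"
  define B where "B = conj_transpose V * Y * V"
  have B: "B \<in> carrier_mat n n" "hermitian_mat B"
    using V Y hermitian_congruence[OF Y V(1) herm(2)]
    by (simp_all add: B_def mult_carrier_mat[of _ n n _ n])
  define B0 where "B0 = mat n n (\<lambda>(i, j). if d i = d j then B $$ (i, j) else 0)"
  obtain P where P: "P \<in> carrier_mat n n" "unitary_mat P"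
    and PB: "conj_transpose P * dual_mat (mat_diag n (\<lambda>p. of_real (d p))) B * P
      = dual_mat (mat_diag n (\<lambda>p. of_real (d p))) B0"
    using decouple_infinitesimal_part[OF B, of d] unfolding B0_def by blast
  have B0: "B0 \<in> carrier_mat n n" by (simp add: B0_def)
  have "hermitian_mat B0"
    using hermitian_index[OF B(2,1)] unfolding hermitian_mat_def
    by (intro eq_matI) (auto simp: B0_def)
  then obtain W e m where W: "W \<in> carrier_mat n n" "unitary_mat W"
    and We: "conj_transpose W * mat_diag n (\<lambda>p. of_real (d p)) * W = mat_diag n (\<lambda>p. of_real (e p))"
    and Wm: "conj_transpose W * B0 * W = mat_diag n (\<lambda>p. of_real (m p))"
    using simultaneous_diagonalization[OF B0, of d] by (auto simp: B0_def)
  let ?W = "dual_mat W (0\<^sub>m n n)"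
  have V': "?V \<in> carrier_mat n n" "unitary_mat ?V"
    and VA: "conj_transpose ?V * A * ?V = dual_mat (mat_diag n (\<lambda>p. of_real (d p))) B"
    using embed[OF V X Y] by (simp_all add: AXY Vd B_def)
  have W': "?W \<in> carrier_mat n n" "unitary_mat ?W"
    and WB: "conj_transpose ?W * dual_mat (mat_diag n (\<lambda>p. of_real (d p))) B0 * ?W
      = dual_mat (mat_diag n (\<lambda>p. of_real (e p))) (mat_diag n (\<lambda>p. of_real (m p)))"
    using embed[OF W mat_diag_dim B0] by (simp_all add: We Wm)
  have "conj_transpose (?V * P * ?W) * A * (?V * P * ?W)
      = dual_mat (mat_diag n (\<lambda>p. of_real (e p))) (mat_diag n (\<lambda>p. of_real (m p)))"
    using congruence_mult[OF A(1) mult_carrier_mat[OF V'(1) P(1)] W'(1)] congruence_mult[OF A(1) V'(1) P(1)]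
    by (simp add: VA PB WB)
  also have "\<dots> = real_dual_diag n e m"
    by (rule eq_matI) (auto simp: mat_diag_def dual_defs real_dual_diag_def)
  finally have "conj_transpose (?V * P * ?W) * A * (?V * P * ?W) = real_dual_diag n e m" .
  moreover have "?V * P * ?W \<in> carrier_mat n n" "unitary_mat (?V * P * ?W)"
    using V' P W' by (auto intro!: unitary_mult[of _ n])
  ultimately show ?thesis by blast
qed

section \<open>Uniqueness of the diagonal\<close>

text \<open>The total weight of the rows with \<open>f p = v\<close> is their number, and likewise
  for the columns with \<open>g q = v\<close>. Both totals run over the same nonzero entries, by the
  support condition.\<close>

lemma unitary_support_card_eq:
  fixes W :: "quat mat" and f g :: "nat \<Rightarrow> 'b"
  assumes W: "W \<in> carrier_mat n n" "unitary_mat W"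
    and supp: "\<And>p q. p < n \<Longrightarrow> q < n \<Longrightarrow> W $$ (p, q) \<noteq> 0 \<Longrightarrow> f p = g q"
  shows "card {p. p < n \<and> f p = v} = card {q. q < n \<and> g q = v}"
proof -
  have cols: "(\<Sum>p<n. qsq (W $$ (p, q))) = 1" if q: "q < n" for q
  proof -
    have "(conj_transpose W * W) $$ (q, q) = of_real (\<Sum>p<n. qsq (W $$ (p, q)))"
      using q W(1) by (subst index_mult_mat_sum[of _ n n _ n]) (auto simp: star_mult_self)
    moreover have "(conj_transpose W * W) $$ (q, q) = of_real 1"
      using W q by (simp add: unitary_mat_iff del: index_mult_mat(1))
    ultimately show ?thesis by (simp only: of_real_eq_iff)
  qed
  have rows: "(\<Sum>q<n. qsq (W $$ (p, q))) = 1" if p: "p < n" for p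
  proof -
    have "(W * conj_transpose W) $$ (p, p) = of_real (\<Sum>q<n. qsq (W $$ (p, q)))"
      using p W(1) by (subst index_mult_mat_sum[of _ n n _ n]) (auto simp: mult_star_self)
    moreover have "(W * conj_transpose W) $$ (p, p) = of_real 1"
      using quat_unitary_right_inverse[OF W] p by simp
    ultimately show ?thesis by (simp only: of_real_eq_iff)
  qed
  have ind: "(\<Sum>p<n. if h p = v then 1 else 0) = real (card {p. p < n \<and> h p = v})" for h :: "nat \<Rightarrow> 'b"
    by (simp flip: sum.inter_filter)
  have "real (card {p. p < n \<and> f p = v})
      = (\<Sum>p<n. \<Sum>q<n. if f p = v then qsq (W $$ (p, q)) else 0)"
    unfolding ind[symmetric] by (intro sum.cong) (auto simp: rows)
  also have "\<dots> = (\<Sum>p<n. \<Sum>q<n. if g q = v then qsq (W $$ (p, q)) else 0)"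
    using supp by (intro sum.cong) (auto, metis+)
  also have "\<dots> = (\<Sum>q<n. \<Sum>p<n. if g q = v then qsq (W $$ (p, q)) else 0)"
    by (rule sum.swap)
  also have "\<dots> = real (card {q. q < n \<and> g q = v})"
    unfolding ind[symmetric] by (intro sum.cong) (auto simp: cols)
  finally show ?thesis by simp
qed

text \<open>The matrix \<open>W\<close> = U* U' is unitary and intertwines the two diagonals, so the
  counting lemma applies to its standard part. The pairs are negated to match the sorting order used
  later.\<close>

lemma real_dual_diag_card_eq:
  fixes A :: "quat dual mat"
  assumes A: "A \<in> carrier_mat n n"
    and U: "U \<in> carrier_mat n n" "unitary_mat U" "conj_transpose U * A * U = real_dual_diag n d m"
    and U': "U' \<in> carrier_mat n n" "unitary_mat U'" "conj_transpose U' * A * U' = real_dual_diag n d' m'"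
  shows "card {p. p < n \<and> (- d p, - m p) = v} = card {q. q < n \<and> (- d' q, - m' q) = v}"
proof -
  let ?S = "real_dual_diag n d m" and ?S' = "real_dual_diag n d' m'"
  have S: "?S \<in> carrier_mat n n" "?S' \<in> carrier_mat n n" by (simp_all add: real_dual_diag_def)
  define C where "C = conj_transpose U"
  have C: "C \<in> carrier_mat n n" using U by (simp add: C_def)
  have UC: "U * C = 1\<^sub>m n" unfolding C_def using U by (intro dual_unitary_right_inverse)
  define W where "W = C * U'"
  have W: "W \<in> carrier_mat n n" using C U' by (simp add: W_def)
  have "conj_transpose W = conj_transpose U' * U"
    using C U(1) U'(1) by (simp add: W_def C_def conj_transpose_mult[of _ n n _ n])
  then have "conj_transpose W * W = conj_transpose U' * ((U * C) * U')"
    using C U(1) U'(1)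
    by (simp add: W_def assoc_mult_mat[of _ n n _ n _ n] mult_carrier_mat[of _ n n _ n])
  then have "unitary_mat W"
    using U' W by (simp add: UC unitary_mat_iff)
  have "?S * W = C * A * ((U * C) * U')"
    using C U(1) U'(1) A unfolding U(3)[symmetric] C_def[symmetric] W_def
    by (simp add: assoc_mult_mat[of _ n n _ n _ n] mult_carrier_mat[of _ n n _ n])
  also have "\<dots> = C * (A * U')"
    using C A U'(1) by (simp add: UC assoc_mult_mat[of _ n n _ n _ n])
  also have "A * U' = U' * ?S'"
    using U'(3) congruence_eq_iff[OF A U'(1) S(2) U'(2) dual_unitary_right_inverse[OF U'(1,2)]] by simp
  also have "C * (U' * ?S') = W * ?S'"
    using C U'(1) S by (simp add: W_def assoc_mult_mat[of _ n n _ n _ n])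
  finally have SW: "?S * W = W * ?S'" .
  define V where "V = map_mat std_part W"
  have V: "V \<in> carrier_mat n n" using W by (simp add: V_def)
  have "unitary_mat V"
    using \<open>unitary_mat W\<close> W V unitary_dual_mat[OF V, of "map_mat inf_part W"]
    unfolding V_def dual_mat_parts by simp
  moreover have "(- d p, - m p) = (- d' q, - m' q)" if p: "p < n" and q: "q < n" and nz: "V $$ (p, q) \<noteq> 0" for p q
  proof -
    have "(?S * W) $$ (p, q) = Dual (of_real (d p)) (of_real (m p)) * W $$ (p, q)"
      using p q W by (simp add: real_dual_diag_def mat_diag_mult_left[of _ n n] del: index_mult_mat(1))
    moreover have "(W * ?S') $$ (p, q) = W $$ (p, q) * Dual (of_real (d' q)) (of_real (m' q))"
      using p q W by (simp add: real_dual_diag_def mat_diag_mult_right[of _ n n] del: index_mult_mat(1))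
    ultimately have eq: "Dual (of_real (d p)) (of_real (m p)) * W $$ (p, q)
        = W $$ (p, q) * Dual (of_real (d' q)) (of_real (m' q))"
      using SW by simp
    have nz': "std_part (W $$ (p, q)) \<noteq> 0" using nz p q W by (simp add: V_def)
    have "d p *\<^sub>R std_part (W $$ (p, q)) = d' q *\<^sub>R std_part (W $$ (p, q))"
      using arg_cong[OF eq, of std_part] by (simp add: dual_defs of_real_def)
    then have d: "d p = d' q" using nz' by simp
    \<comment> \<open>Once \<open>d p = d' q\<close>, the terms containing the infinitesimal part of
      the entry of \<open>W\<close> cancel.\<close>
    have "m p *\<^sub>R std_part (W $$ (p, q)) = m' q *\<^sub>R std_part (W $$ (p, q))"
      using arg_cong[OF eq, of inf_part] d by (simp add: dual_defs of_real_def)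
    then show ?thesis using nz' d by simp
  qed
  ultimately show ?thesis by (rule unitary_support_card_eq[OF V])
qed

text \<open>Both lists of values are sorted and have the same multiset of elements, and a multiset
  has only one sorted list.\<close>

lemma mono_on_eq_of_card_eq:
  fixes f g :: "nat \<Rightarrow> 'a::linorder"
  assumes "mono_on {..<n} f" "mono_on {..<n} g"
    and card: "\<And>v. card {p. p < n \<and> f p = v} = card {p. p < n \<and> g p = v}"
    and "p < n"
  shows "f p = g p"
proof -
  have count: "count (mset (map h [0..<n])) v = card {p. p < n \<and> h p = v}" for h :: "nat \<Rightarrow> 'a" and v
    unfolding count_mset count_list_eq_length_filter length_filter_conv_card
    by (rule arg_cong[of _ _ card]) auto
  have sorted: "sorted (map h [0..<n])" if "mono_on {..<n} h" for h :: "nat \<Rightarrow> 'a"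
    using that by (auto simp: sorted_iff_nth_mono mono_on_def)
  have "mset (map f [0..<n]) = mset (map g [0..<n])"
    by (rule multiset_eqI) (simp only: count card)
  then have "map f [0..<n] = map g [0..<n]"
    using assms(1,2) by (metis properties_for_sort sorted)
  with \<open>p < n\<close> show ?thesis by simp
qed

section \<open>Sorting the diagonal and grouping it into blocks\<close>

lemma ex_sorting_permutation:
  fixes f :: "nat \<Rightarrow> 'a::linorder"
  obtains s where "s permutes {..<n}" "mono_on {..<n} (f \<circ> s)"
proof -
  obtain s where s: "s permutes {..<length (map f [0..<n])}"
    and eq: "permute_list s (map f [0..<n]) = sort (map f [0..<n])"
    using mset_eq_permutation[of "sort (map f [0..<n])" "map f [0..<n]"] by auto
  have s': "s permutes {..<n}" using s by simp
  have nth: "sort (map f [0..<n]) ! i = f (s i)" if "i < n" for i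
    using that s' permutes_in_image[OF s', of i]
    unfolding eq[symmetric] by (simp add: permute_list_def)
  have "mono_on {..<n} (f \<circ> s)"
    using sorted_sort[of "map f [0..<n]"] nth
    by (auto simp: mono_on_def sorted_iff_nth_mono)
  with s' show ?thesis by (rule that)
qed

lemma congruence_permute_cols:
  fixes A U :: "'a::star_ring mat"
  assumes A: "A \<in> carrier_mat n n" and U: "U \<in> carrier_mat n n" and s: "s permutes {..<n}"
  defines "U' \<equiv> mat n n (\<lambda>(i, j). U $$ (i, s j))"
  shows "conj_transpose U' * A * U' = mat n n (\<lambda>(i, j). (conj_transpose U * A * U) $$ (s i, s j))"
proof (rule eq_matI)
  fix i j
  assume "i < dim_row (mat n n (\<lambda>(i, j). (conj_transpose U * A * U) $$ (s i, s j)))"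
    "j < dim_col (mat n n (\<lambda>(i, j). (conj_transpose U * A * U) $$ (s i, s j)))"
  then have ij: "i < n" "j < n" by auto
  have s: "s k < n" if "k < n" for k using that permutes_in_image[OF s, of k] by simp
  have U': "U' \<in> carrier_mat n n" by (simp add: U'_def)
  have "(conj_transpose U' * A * U') $$ (i, j)
      = (\<Sum>t<n. (\<Sum>k<n. star (U' $$ (k, i)) * A $$ (k, t)) * U' $$ (t, j))"
    using A U' ij
    by (simp add: index_mult_mat_sum[of _ n n _ n] mult_carrier_mat[of _ n n _ n] del: index_mult_mat(1))
  also have "\<dots> = (\<Sum>t<n. (\<Sum>k<n. star (U $$ (k, s i)) * A $$ (k, t)) * U $$ (t, s j))"
    using ij by (simp add: U'_def)
  also have "\<dots> = (conj_transpose U * A * U) $$ (s i, s j)"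
    using A U s ij
    by (simp add: index_mult_mat_sum[of _ n n _ n] mult_carrier_mat[of _ n n _ n] del: index_mult_mat(1))
  finally show "(conj_transpose U' * A * U') $$ (i, j)
    = mat n n (\<lambda>(i, j). (conj_transpose U * A * U) $$ (s i, s j)) $$ (i, j)"
    using ij by simp
qed (simp_all add: U'_def)

text \<open>Increasing lexicographic order of the negated pairs means that \<open>d\<close>
  decreases and that \<open>m\<close> decreases wherever \<open>d\<close> is constant.\<close>

lemma dual_spectral_theorem_sorted:
  fixes A :: "quat dual mat"
  assumes A: "A \<in> carrier_mat n n" "hermitian_mat A"
  obtains U d m where "U \<in> carrier_mat n n" "unitary_mat U"
    "conj_transpose U * A * U = real_dual_diag n d m" "mono_on {..<n} (\<lambda>p. (- d p, - m p))"
proof -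
  obtain U d m where U: "U \<in> carrier_mat n n" "unitary_mat U"
    and UA: "conj_transpose U * A * U = real_dual_diag n d m"
    using dual_spectral_theorem[OF A] by blast
  obtain s where s: "s permutes {..<n}" and mono: "mono_on {..<n} ((\<lambda>p. (- d p, - m p)) \<circ> s)"
    using ex_sorting_permutation by blast
  define U' where "U' = mat n n (\<lambda>(i, j). U $$ (i, s j))"
  have U': "U' \<in> carrier_mat n n" by (simp add: U'_def)
  have sn: "s k < n" if "k < n" for k using that permutes_in_image[OF s, of k] by simp
  have inj: "s i = s j \<longleftrightarrow> i = j" for i j using permutes_inj[OF s] by (auto dest: injD)
  \<comment> \<open>Unitarity of the permuted matrix is the permuted congruence of the identity
    matrix.\<close>
  have "conj_transpose U' * 1\<^sub>m n * U' = 1\<^sub>m n"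
    unfolding U'_def congruence_permute_cols[OF one_carrier_mat U(1) s]
    using U sn by (intro eq_matI) (auto simp: unitary_mat_iff inj right_mult_one_mat[of _ n n] simp del: index_mult_mat(1))
  then have "unitary_mat U'" using U' by (simp add: unitary_mat_iff right_mult_one_mat[of _ n n])
  moreover have "conj_transpose U' * A * U' = real_dual_diag n (d \<circ> s) (m \<circ> s)"
    unfolding U'_def congruence_permute_cols[OF A(1) U(1) s] UA
    using sn by (intro eq_matI) (auto simp: real_dual_diag_def mat_diag_def inj)
  moreover have "mono_on {..<n} (\<lambda>p. (- (d \<circ> s) p, - (m \<circ> s) p))" using mono by (simp add: o_def)
  ultimately show ?thesis using U' that by blast
qed

section \<open>Block labels and flat positions\<close>

lemma block_pos_exhaust:
  assumes "p < (\<Sum>i<r. k i)"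
  obtains i j where "i < r" "j < k i" "p = block_pos k i j"
  using assms
proof (induction r arbitrary: thesis)
  case (Suc r)
  show ?case
  proof (cases "p < (\<Sum>i<r. k i)")
    case True
    with Suc.IH Suc.prems(1) show ?thesis by (metis less_SucI)
  next
    case False
    with Suc.prems(2) show ?thesis
      by (intro Suc.prems(1)[of r "p - (\<Sum>i<r. k i)"]) (auto simp: block_pos_def)
  qed
qed simp

text \<open>Together with \<open>block_pos_exhaust\<close> this shows that the labels
  \<open>(i, j)\<close> enumerate the positions in lexicographic order.\<close>

lemma block_pos_less:
  assumes "i < i'" "j < k i"
  shows "block_pos k i j < block_pos k i' j'"
proof -
  have "block_pos k i j < (\<Sum>p<Suc i. k p)" using assms(2) by (simp add: block_pos_def)
  also have "\<dots> \<le> (\<Sum>p<i'. k p)" using assms(1) by (intro sum_mono2) auto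
  finally show ?thesis by (simp add: block_pos_def)
qed

text \<open>This removes the block data from uniqueness: decreasing \<open>l\<close> between blocks
  and decreasing \<open>m\<close> inside a block amount to one sorted sequence of pairs.\<close>

lemma ordered_diagonal_form_sorted:
  assumes "ordered_diagonal_form n r k l m S"
  obtains d \<mu> where "S = real_dual_diag n d \<mu>" "mono_on {..<n} (\<lambda>p. (- d p, - \<mu> p))"
proof -
  have S: "S \<in> carrier_mat n n" "diagonal_mat S" and n: "(\<Sum>i<r. k i) = n"
    and entry: "\<And>i j. i < r \<Longrightarrow> j < k i \<Longrightarrow>
      S $$ (block_pos k i j, block_pos k i j) = Dual (of_real (l i)) (of_real (m i j))"
    and l: "\<And>i i'. i < i' \<Longrightarrow> i' < r \<Longrightarrow> l i > l i'"
    and m: "\<And>i j j'. i < r \<Longrightarrow> j \<le> j' \<Longrightarrow> j' < k i \<Longrightarrow> m i j \<ge> m i j'"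
    using assms by (simp_all add: ordered_diagonal_form_def)
  define d where "d p = QRe (std_part (S $$ (p, p)))" for p
  define \<mu> where "\<mu> p = QRe (inf_part (S $$ (p, p)))" for p
  have block: "d (block_pos k i j) = l i" "\<mu> (block_pos k i j) = m i j" if "i < r" "j < k i" for i j
    using entry[OF that] by (simp_all add: d_def \<mu>_def)
  have diag: "S $$ (p, p) = Dual (of_real (d p)) (of_real (\<mu> p))" if "p < n" for p
    using that entry block unfolding n[symmetric] by (metis block_pos_exhaust)
  have "S = real_dual_diag n d \<mu>"
    using S diag by (intro eq_matI) (auto simp: real_dual_diag_def mat_diag_def diagonal_mat_def)
  moreover have "mono_on {..<n} (\<lambda>p. (- d p, - \<mu> p))"
  proof (rule mono_onI)
    fix p q assume "p \<in> {..<n}" "q \<in> {..<n}" and pq: "p \<le> q"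
    then have "p < (\<Sum>i<r. k i)" "q < (\<Sum>i<r. k i)" using n by auto
    then obtain i j i' j' where ij: "i < r" "j < k i" "p = block_pos k i j"
      and ij': "i' < r" "j' < k i'" "q = block_pos k i' j'"
      by (metis block_pos_exhaust)
    have "\<not> i' < i" using block_pos_less[of i' i j' k j] ij ij' pq by auto
    then consider "i < i'" | "i = i'" "j \<le> j'" using ij ij' pq by (auto simp: block_pos_def not_less le_less)
    then show "(- d p, - \<mu> p) \<le> (- d q, - \<mu> q)"
      using ij ij' block l m by cases (auto simp: less_eq_prod_def)
  qed
  ultimately show ?thesis by (rule that)
qed

lemma downset_eq_lessThan_card:
  fixes P :: "nat set"
  assumes "finite P" "\<And>p q. q \<in> P \<Longrightarrow> p \<le> q \<Longrightarrow> p \<in> P"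
  shows "P = {..<card P}"
proof (cases "P = {}")
  case False
  have "P = {..Max P}" using assms False by (auto intro: Max_ge Max_in)
  then show ?thesis by (metis card_atMost lessThan_Suc_atMost)
qed simp

text \<open>The blocks are the level sets of \<open>d\<close>: as \<open>d\<close> is decreasing, the positions with \<open>d p > l i\<close>
  form an initial segment, whose length is the start of block \<open>i\<close>.\<close>

lemma sorted_blocks:
  assumes mono: "mono_on {..<n} (\<lambda>p. (- d p, - \<mu> p :: real))"
  obtains r k l m where "\<And>i. i < r \<Longrightarrow> 0 < k i" "(\<Sum>i<r. k i) = n"
    "\<And>i j. i < r \<Longrightarrow> j < k i \<Longrightarrow> block_pos k i j < n"
    "\<And>i j. i < r \<Longrightarrow> j < k i \<Longrightarrow> d (block_pos k i j) = l i"
    "\<And>i j. i < r \<Longrightarrow> j < k i \<Longrightarrow> \<mu> (block_pos k i j) = m i j"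
    "\<And>i i'. i < i' \<Longrightarrow> i' < r \<Longrightarrow> (l i :: real) > l i'"
    "\<And>i j j'. i < r \<Longrightarrow> j \<le> j' \<Longrightarrow> j' < k i \<Longrightarrow> m i j \<ge> m i j'"
    "\<And>i. i < r \<Longrightarrow> card {p. p < n \<and> d p = l i} = k i"
proof -
  \<comment> \<open>The distinct values of \<open>d\<close> in decreasing order, one for each
    block.\<close>
  define L where "L = rev (sorted_list_of_set (d ` {..<n}))"
  define r where "r = length L"
  define l where "l i = L ! i" for i
  define k where "k i = card {p. p < n \<and> d p = l i}" for i
  define m where "m i j = \<mu> (block_pos k i j)" for i j
  have setL: "set L = d ` {..<n}" by (simp add: L_def)
  have l_less: "l i > l i'" if "i < i'" "i' < r" for i i'
  proof -
    have "sorted_wrt (>) L" by (simp add: L_def sorted_wrt_rev)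
    then show ?thesis using that by (simp add: sorted_wrt_iff_nth_less r_def l_def)
  qed
  have l_eq: "l i = l i' \<Longrightarrow> i = i'" if "i < r" "i' < r" for i i'
    using that l_less[of i i'] l_less[of i' i] by (cases i i' rule: linorder_cases) auto
  have ex: "\<exists>i<r. d p = l i" if "p < n" for p
  proof -
    have "d p \<in> set L" using that setL by auto
    then show ?thesis by (auto simp: in_set_conv_nth r_def l_def)
  qed
  have card_UN: "(\<Sum>i'<i. k i') = card {p. p < n \<and> (\<exists>i'<i. d p = l i')}" if "i \<le> r" for i
  proof -
    have "(\<Sum>i'<i. k i') = card (\<Union>i'<i. {p. p < n \<and> d p = l i'})"
      unfolding k_def using that l_eq
      by (intro card_UN_disjoint[symmetric]) (auto dest: less_le_trans)
    also have "(\<Union>i'<i. {p. p < n \<and> d p = l i'}) = {p. p < n \<and> (\<exists>i'<i. d p = l i')}" by auto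
    finally show ?thesis .
  qed
  have antimono: "d p \<ge> d q" if "p \<le> q" "q < n" for p q
    using mono_onD[OF mono, of p q] that by (auto simp: less_eq_prod_def)
  have initial: "{p. p < n \<and> (\<exists>i'<i. d p = l i')} = {..<(\<Sum>i'<i. k i')}" if i: "i \<le> r" for i
    unfolding card_UN[OF i]
  proof (rule downset_eq_lessThan_card)
    fix p q
    assume q: "q \<in> {p. p < n \<and> (\<exists>i'<i. d p = l i')}" and pq: "p \<le> q"
    then obtain i' where i': "i' < i" "d q = l i'" and qn: "q < n" by auto
    obtain i2 where i2: "i2 < r" "d p = l i2" using ex[of p] pq qn by auto
    have "\<not> i' < i2" using l_less[of i' i2] i2 i' antimono[OF pq qn] by auto
    then have "i2 < i" using i' by simp
    then show "p \<in> {p. p < n \<and> (\<exists>i'<i. d p = l i')}" using i2 pq qn by auto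
  qed simp
  \<comment> \<open>The position lies in the initial segment formed by blocks 0 to \<open>i\<close>
    but not in the one formed by the blocks before \<open>i\<close>, which pins the value of
    \<open>d\<close> to \<open>l i\<close>.\<close>
  have in_block: "block_pos k i j < n \<and> d (block_pos k i j) = l i" if i: "i < r" and j: "j < k i" for i j
  proof -
    have "block_pos k i j \<in> {..<(\<Sum>i'<Suc i. k i')}" using j by (simp add: block_pos_def)
    then have "block_pos k i j \<in> {p. p < n \<and> (\<exists>i'<Suc i. d p = l i')}"
      using initial[of "Suc i"] i by (simp del: lessThan_iff sum.lessThan_Suc)
    moreover have "block_pos k i j \<notin> {..<(\<Sum>i'<i. k i')}" by (simp add: block_pos_def)
    then have "block_pos k i j \<notin> {p. p < n \<and> (\<exists>i'<i. d p = l i')}"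
      using initial[of i] i by (simp del: lessThan_iff)
    ultimately show ?thesis by (auto simp: less_Suc_eq)
  qed
  have "0 < k i" if "i < r" for i
  proof -
    have "l i \<in> d ` {..<n}" using that setL by (metis l_def r_def nth_mem)
    then show ?thesis by (auto simp: k_def card_gt_0_iff)
  qed
  moreover have "(\<Sum>i<r. k i) = n"
  proof -
    have "{p. p < n \<and> (\<exists>i'<r. d p = l i')} = {..<n}" using ex by auto
    then show ?thesis using initial[of r] by (metis card_lessThan order_refl)
  qed
  moreover have "m i j \<ge> m i j'" if "i < r" "j \<le> j'" "j' < k i" for i j j'
  proof -
    have j: "j < k i" using that by simp
    have "block_pos k i j \<le> block_pos k i j'" using that by (simp add: block_pos_def)
    then show ?thesis
      using mono_onD[OF mono, of "block_pos k i j" "block_pos k i j'"] in_block[OF that(1) j] in_block[OF that(1,3)]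
      by (auto simp: m_def less_eq_prod_def)
  qed
  ultimately show ?thesis using in_block l_less by (intro that[of r k l m]) (auto simp: m_def k_def)
qed

section \<open>The ordered diagonal form: eigenvectors, multiplicities and uniqueness\<close>

theorem theorem4p1:
  fixes A :: "quat dual mat" and n :: nat
  assumes "A \<in> carrier_mat n n"
    and "hermitian_mat A"
    and "map_mat std_part A \<noteq> 0\<^sub>m n n"
  shows "\<exists>U \<Sigma> r k l m.
    U \<in> carrier_mat n n \<and> unitary_mat U \<and>
    \<Sigma> = conj_transpose U * A * U \<and>
    ordered_diagonal_form n r k l m \<Sigma> \<and>
    (\<forall>p<n. dq_eigenvalue A (\<Sigma> $$ (p, p))) \<and>
    (\<forall>i<r. \<forall>j<k i. A *\<^sub>v col U (block_pos k i j)
       = rsmult_vec (col U (block_pos k i j)) (Dual (of_real (l i)) (of_real (m i j)))) \<and>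
    (\<forall>i<r. multiple_right_eigenvalue (k i) (map_mat std_part A) (of_real (l i))) \<and>
    (\<forall>U' \<Sigma>' r' k' l' m'.
       U' \<in> carrier_mat n n \<and> unitary_mat U' \<and>
       \<Sigma>' = conj_transpose U' * A * U' \<and>
       ordered_diagonal_form n r' k' l' m' \<Sigma>' \<longrightarrow> \<Sigma>' = \<Sigma>)"
proof -
  note A = assms(1)
  obtain U d \<mu> where U: "U \<in> carrier_mat n n" "unitary_mat U"
    and UA: "conj_transpose U * A * U = real_dual_diag n d \<mu>"
    and mono: "mono_on {..<n} (\<lambda>p. (- d p, - \<mu> p))"
    using dual_spectral_theorem_sorted[OF assms(1,2)] .
  obtain r k l m where k: "\<And>i. i < r \<Longrightarrow> 0 < k i" and n: "(\<Sum>i<r. k i) = n"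
    and pos: "\<And>i j. i < r \<Longrightarrow> j < k i \<Longrightarrow> block_pos k i j < n"
    and d: "\<And>i j. i < r \<Longrightarrow> j < k i \<Longrightarrow> d (block_pos k i j) = l i"
    and \<mu>: "\<And>i j. i < r \<Longrightarrow> j < k i \<Longrightarrow> \<mu> (block_pos k i j) = m i j"
    and l: "\<And>i i'. i < i' \<Longrightarrow> i' < r \<Longrightarrow> l i > l i'"
    and m: "\<And>i j j'. i < r \<Longrightarrow> j \<le> j' \<Longrightarrow> j' < k i \<Longrightarrow> m i j \<ge> m i j'"
    and card: "\<And>i. i < r \<Longrightarrow> card {p. p < n \<and> d p = l i} = k i"
    using mono by (rule sorted_blocks) (rule that)
  define \<Sigma> where "\<Sigma> = real_dual_diag n d \<mu>"
  have \<Sigma>: "\<Sigma> \<in> carrier_mat n n" by (simp add: \<Sigma>_def real_dual_diag_def)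
  have entry: "\<Sigma> $$ (p, p) = Dual (of_real (d p)) (of_real (\<mu> p))" if "p < n" for p
    using that by (simp add: \<Sigma>_def real_dual_diag_def mat_diag_def)
  have "diagonal_mat \<Sigma>"
    by (simp add: \<Sigma>_def real_dual_diag_def mat_diag_def diagonal_mat_def)
  then have form: "ordered_diagonal_form n r k l m \<Sigma>"
    using \<Sigma> k n pos d \<mu> l m by (simp add: ordered_diagonal_form_def entry)
  have AU: "A * U = U * \<Sigma>"
    using UA congruence_eq_iff[OF A U(1) \<Sigma> U(2) dual_unitary_right_inverse[OF U]]
    by (simp add: \<Sigma>_def)
  have ev: "A *\<^sub>v col U p = rsmult_vec (col U p) (\<Sigma> $$ (p, p))" if p: "p < n" for p
  proof -
    have "A *\<^sub>v col U p = col (A * U) p" using col_mult2[OF A U(1) p] by simp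
    also have "\<dots> = rsmult_vec (col U p) (\<Sigma> $$ (p, p))"
      using U(1) p unfolding AU entry[OF p] \<Sigma>_def real_dual_diag_def mat_diag_mult_right[OF U(1)]
      by (intro eq_vecI) (auto simp: rsmult_vec_def mat_diag_def)
    finally show ?thesis .
  qed
  \<comment> \<open>The standard part of \<open>U\<close> is a unitary matrix that diagonalizes the
    standard part of \<open>A\<close> with diagonal \<open>d\<close>; it is the witness for the
    multiplicities.\<close>
  define X V where "X = map_mat std_part A" and "V = map_mat std_part U"
  have X: "X \<in> carrier_mat n n" and V: "V \<in> carrier_mat n n"
    using A U by (simp_all add: X_def V_def)
  have "unitary_mat V"
    using U V unitary_dual_mat[OF V, of "map_mat inf_part U"]
    unfolding V_def dual_mat_parts by simp
  have "conj_transpose V * X * V = map_mat std_part (conj_transpose U * A * U)"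
    using A U by (simp add: V_def X_def map_std_part_mult[of _ n n _ n] map_std_part_conj_transpose
        mult_carrier_mat[of _ n n _ n])
  also have "\<dots> = mat_diag n (\<lambda>p. of_real (d p))"
    unfolding UA by (rule eq_matI) (auto simp: real_dual_diag_def mat_diag_def dual_defs)
  finally have VX: "conj_transpose V * X * V = mat_diag n (\<lambda>p. of_real (d p))" .
  have eigenvalue: "dq_eigenvalue A (\<Sigma> $$ (p, p))" if p: "p < n" for p
  proof -
    have "appreciable_vec (col U p)"
      using unitary_col_nonzero[OF V \<open>unitary_mat V\<close> p] U p by (auto simp: appreciable_vec_def V_def)
    moreover have "col U p \<in> carrier_vec (dim_row A)" using A U p by simp
    ultimately have "dq_right_eigenvalue A (\<Sigma> $$ (p, p))"
      unfolding dq_right_eigenvalue_def using ev[OF p] by blast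
    then show ?thesis by (simp add: dq_eigenvalue_def is_dual_number_def entry[OF p])
  qed
  have multiple: "multiple_right_eigenvalue (k i) X (of_real (l i))" if i: "i < r" for i
  proof -
    \<comment> \<open>Blocks are nonempty, so the first position of block \<open>i\<close> exists
      and its column is an eigenvector for \<open>l i\<close>.\<close>
    define p where "p = block_pos k i 0"
    have p: "p < n" "d p = l i" using pos[OF i k[OF i]] d[OF i k[OF i]] by (simp_all add: p_def)
    have "X *\<^sub>v col V p = rsmult_vec (col V p) (of_real (l i))"
      using X V p VX[unfolded quat_diagonalizes_iff[OF X V \<open>unitary_mat V\<close>]]
      by (intro eq_vecI)
        (simp_all add: rsmult_vec_def index_mult_mat_vec_sum[of _ n n] of_real_def del: index_mult_mat_vec)
    moreover have "col V p \<noteq> 0\<^sub>v n"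
      using unitary_col_nonzero[OF V \<open>unitary_mat V\<close> p(1)] V p(1)
      by (metis carrier_matD index_col index_zero_vec(1))
    moreover have "col V p \<in> carrier_vec n" using V p by simp
    ultimately have "quat_right_eigenvalue X (of_real (l i))"
      using X by (auto simp: quat_right_eigenvalue_def)
    moreover have "card {p. p < n \<and> (of_real (d p) :: quat) = of_real (l i)} = k i"
      using card[OF i] by simp
    ultimately show ?thesis
      using X V VX \<open>unitary_mat V\<close> unfolding multiple_right_eigenvalue_def by auto
  qed
  have unique: "\<Sigma>' = \<Sigma>"
    if U': "U' \<in> carrier_mat n n" "unitary_mat U'" "\<Sigma>' = conj_transpose U' * A * U'"
      and form': "ordered_diagonal_form n r' k' l' m' \<Sigma>'" for U' \<Sigma>' r' k' l' m'
  proof -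
    obtain d' \<mu>' where \<Sigma>': "\<Sigma>' = real_dual_diag n d' \<mu>'"
      and mono': "mono_on {..<n} (\<lambda>p. (- d' p, - \<mu>' p))"
      using ordered_diagonal_form_sorted[OF form'] .
    \<comment> \<open>Both diagonals are sorted and contain every pair equally often, so they agree
      position by position, whatever block data \<open>r'\<close>, \<open>k'\<close>,
      \<open>l'\<close>, \<open>m'\<close> describe the second one.\<close>
    have "(- d p, - \<mu> p) = (- d' p, - \<mu>' p)" if "p < n" for p
      using mono mono' real_dual_diag_card_eq[OF A U UA U'(1,2)] U'(3) \<Sigma>' that
      by (intro mono_on_eq_of_card_eq[where f = "\<lambda>p. (- d p, - \<mu> p)" and g = "\<lambda>p. (- d' p, - \<mu>' p)"]) auto
    then show ?thesis
      unfolding \<Sigma>' \<Sigma>_def by (intro eq_matI) (auto simp: real_dual_diag_def mat_diag_def)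
  qed
  show ?thesis
  proof (rule exI[of _ U], rule exI[of _ \<Sigma>], rule exI[of _ r], rule exI[of _ k], rule exI[of _ l],
      rule exI[of _ m], intro conjI allI impI)
    show "\<Sigma> = conj_transpose U * A * U" by (simp only: UA \<Sigma>_def)
    show "A *\<^sub>v col U (block_pos k i j)
        = rsmult_vec (col U (block_pos k i j)) (Dual (of_real (l i)) (of_real (m i j)))"
      if "i < r" "j < k i" for i j
      using ev[OF pos[OF that]] by (simp only: entry[OF pos[OF that]] d[OF that] \<mu>[OF that])
    show "multiple_right_eigenvalue (k i) (map_mat std_part A) (of_real (l i))" if "i < r" for i
      using multiple[OF that] by (simp only: X_def)
    show "\<Sigma>' = \<Sigma>"
      if "U' \<in> carrier_mat n n \<and> unitary_mat U' \<and> \<Sigma>' = conj_transpose U' * A * U' \<and>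
        ordered_diagonal_form n r' k' l' m' \<Sigma>'" for U' \<Sigma>' r' k' l' m'
      using unique that by blast
  qed (fact U form eigenvalue)+
qed

end
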